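(* Suppose that $\bm{\psi}:\mathbb{R}^n\to\mathbb{R}_+$ is a convex function and for each $j\in\mathbb{N}_d$, $\mathbf{B}_j$ is an $m_j\times n$ real matrix; let $\mathbf{B}$, $r$, $\mathbf{B}'$, $\mathbf{I}'_j$, $\mathbb{M}$ be as in the context, and let $\lambda_j>0$, $j\in\mathbb{N}_d$. Suppose that $\mathbf{w}:=\begin{bmatrix}\mathbf{z}\\ \mathbf{v}\end{bmatrix}\in\mathbb{R}^{p_d+n-r}$ with $\mathbf{v}\in\mathbb{R}^{n-r}$, $\mathbf{z}\in\mathbb{R}^{p_d}$ and, for each $j\in\mathbb{N}_d$, $\mathbf{z}_j=\sum_{i\in\mathbb{N}_{l_j}}z^*_{p_{j-1}+k_i}\mathbf{e}_{m_j,k_i}\in\Omega_{m_j,l_j}$ for some $l_j\in\mathbb{Z}_{m_j+1}$, and in addition $\hat{\mathbf{a}}\in\mathbb{R}^n$, $\mathbf{c}:=[c_j:j\in\mathbb{N}_{p_d+n-r}]\in\mathbb{R}^{p_d+n-r}$. If $\mathbf{w}$, $\hat{\mathbf{a}}$ and $\mathbf{c}$ satisfy $$\mathbf{w}=\mathrm{prox}_{\sum_{j\in\mathbb{N}_d}\lambda_j\|\cdot\|_1\circ\mathbf{I}'_j,\,\mathbf{O}}\big(\mathbf{w}-\mathbf{O}^{-1}(\mathbf{B}')^\top\hat{\mathbf{a}}-\mathbf{O}^{-1}\mathbf{c}\big),$$ $$\hat{\mathbf{a}}=\mathrm{prox}_{\bm{\psi}^*,\mathbf{P}}(\mathbf{P}^{-1}\mathbf{B}'\mathbf{w}+\hat{\mathbf{a}}),\qquad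 \mathbf{c}=\mathrm{prox}_{\iota_{\mathbb{M}}^*,\mathbf{Q}}(\mathbf{Q}^{-1}\mathbf{w}+\mathbf{c})$$ for some matrices $\mathbf{O}\in\mathbb{S}_+^{p_d+n-r}$, $\mathbf{P}\in\mathbb{S}_+^n$, $\mathbf{Q}\in\mathbb{S}_+^{p_d+n-r}$, then $\mathbf{u}^*:=\mathbf{B}'\mathbf{w}$ is a solution of $$\min\Big\{\bm{\psi}(\mathbf{u})+\sum_{j\in\mathbb{N}_d}\lambda_j\|\mathbf{B}_j\mathbf{u}\|_1:\mathbf{u}\in\mathbb{R}^n\Big\}$$ and for each $j\in\mathbb{N}_d$, $\mathbf{u}^*$ has sparsity of level $l_j$ under $\mathbf{B}_j$ (that is, $\mathbf{B}_j\mathbf{u}^*\in\Omega_{m_j,l_j}$). Moreover, $\mathbf{a}:=\hat{\mathbf{a}}\in\partial\bm{\psi}(\mathbf{u}^* )$ and $\mathbf{b}:=[c_j:j\in\mathbb{N}_{p_d}]\in\mathcal{N}(\mathbf{B}^\top)$ satisfy $$(\mathbf{B}'_{(i)})^\top\mathbf{a}=0,\quad i\in\mathbb{N}_{p_d+n-r}\setminus\mathbb{N}_{p_d},$$ and for each $j\in\mathbb{N}_d$ $$\lambda_j=-\big((\mathbf{B}'_{(p_{j-1}+k_i)})^\top\mathbf{a}+b_{p_{j-1}+k_i}\big)\,\mathrm{sign}(z^*_{p_{j-1}+k_i}),\quad i\in\mathbb{N}_{l_j},$$ $$\lambda_j\ge\big|(\mathbf{B}'_{(p_{j-1}+i)})^\top\mathbf{a}+b_{p_{j-1}+i}\big|,\quad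 i\in\mathbb{N}_{m_j}\setminus\{k_i:i\in\mathbb{N}_{l_j}\}.$$
   Context: Notation: $\mathbb{N}_m:=\{1,\dots,m\}$, $\mathbb{N}_0:=\emptyset$, $\mathbb{Z}_s:=\{0,1,\dots,s-1\}$, $\mathbb{R}_+:=[0,+\infty)$, $\overline{\mathbb{R}}:=\mathbb{R}\cup\{+\infty\}$. Let $n,d\in\mathbb{N}$, $m_j\in\mathbb{N}$ for $j\in\mathbb{N}_d$, $p_0:=0$, $p_j:=\sum_{i\in\mathbb{N}_j}m_i$. For $\mathbf{z}\in\mathbb{R}^{p_d}$, $\mathbf{z}_j:=[z_{p_{j-1}+i}:i\in\mathbb{N}_{m_j}]\in\mathbb{R}^{m_j}$. $\mathbf{e}_{s,i}$ is the $i$-th canonical basis vector of $\mathbb{R}^s$, and $\Omega_{s,l}$ is the set of vectors in $\mathbb{R}^s$ with exactly $l$ nonzero components. Writing $\sum_{i\in\mathbb{N}_{l}}x_{k_i}\mathbf{e}_{s,k_i}\in\Omega_{s,l}$ means that $1\le k_1<\dots<k_l\le s$ and all $x_{k_i}\neq0$; the $k_i$ for block $j$ depend on $j$. $\mathcal{N}(\mathbf{M})$, $\mathcal{R}(\mathbf{M})$, $\mathbf{M}_{(i)}$ are the null space, range and $i$-th column of $\mathbf{M}$. $\partial$ is the convex subdifferential. $\mathbb{S}_+^s$ is the set of $s\times s$ symmetric positive definite matrices. Matrices: $\mathbf{B}\in\mathbb{R}^{p_d\times n}$ is the matrix whose successive row blocks are $\mathbf{B}_1,\dots,\mathbf{B}_d$;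 its rank is $r$ with $0<r\le\min\{p_d,n\}$. Fix an SVD $\mathbf{B}=\mathbf{U}\mathbf{\Lambda}\mathbf{V}^\top$ with $\mathbf{U}$ ($p_d\times p_d$), $\mathbf{V}$ ($n\times n$) orthogonal and nonzero singular values $\sigma_1\ge\dots\ge\sigma_r>0$. Let $\widetilde{\mathbf{U}}_r$ consist of the first $r$ columns of $\mathbf{U}$, $\mathbf{U}':=\mathrm{diag}(\widetilde{\mathbf{U}}_r^\top,\mathbf{I}_{n-r})\in\mathbb{R}^{n\times(p_d+n-r)}$ (block diagonal), $\mathbf{\Lambda}':=\mathrm{diag}(\sigma_1^{-1},\dots,\sigma_r^{-1},1,\dots,1)\in\mathbb{R}^{n\times n}$, and $\mathbf{B}':=\mathbf{V}\mathbf{\Lambda}'\mathbf{U}'\in\mathbb{R}^{n\times(p_d+n-r)}$. $\mathbb{M}:=\mathcal{R}(\mathbf{B})\times\mathbb{R}^{n-r}\subseteq\mathbb{R}^{p_d+n-r}$, and $\iota_{\mathbb{M}}$ is its indicator function ($0$ on $\mathbb{M}$, $+\infty$ elsewhere). $\mathbf{I}'_j\in\mathbb{R}^{m_j\times(p_d+n-r)}$ is $[\mathbf{0}_{m_j\times p_{j-1}}\ \mathbf{I}_{m_j}\ \mathbf{0}_{m_j\times(p_d-p_j)}\ \mathbf{0}_{m_j\times(n-r)}]$, i.e. it extracts the $j$-th block $\mathbf{z}_j$. For convex $f:\mathbb{R}^s\to\overline{\mathbb{R}}$ with nonempty domain and $\mathbf{H}\in\mathbb{S}_+^s$, $\mathrm{prox}_{f,\mathbf{H}}(\mathbf{x}):=\mathrm{argmin}\{\frac12\langle\mathbf{y}-\mathbf{x},\mathbf{H}(\mathbf{y}-\mathbf{x})\rangle+f(\mathbf{y}):\mathbf{y}\in\mathbb{R}^s\}$,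 and $f^*(\mathbf{y}):=\sup\{\langle\mathbf{x},\mathbf{y}\rangle-f(\mathbf{x}):\mathbf{x}\in\mathbb{R}^s\}$ is the conjugate. *)

theory Defs
  imports
    "Jordan_Normal_Form.Matrix"
    "Jordan_Normal_Form.Matrix_Kernel"
    "Jordan_Normal_Form.Gauss_Jordan_Elimination"
    "Jordan_Normal_Form.DL_Rank"
    "HOL-Library.Extended_Real"
begin

(* Vectors of R^s are the elements of carrier_vec s. All indices (of blocks, of components, of
   rows and columns) start at 0. *)

definition l1_norm :: "real vec \<Rightarrow> real" where
  "l1_norm x = (\<Sum>i<dim_vec x. \<bar>x $ i\<bar>)"

definition sparse_vecs :: "nat \<Rightarrow> nat \<Rightarrow> real vec set" where
  "sparse_vecs s l = {x \<in> carrier_vec s. card {i. i < s \<and> x $ i \<noteq> 0} = l}"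

definition convex_fun :: "nat \<Rightarrow> (real vec \<Rightarrow> real) \<Rightarrow> bool" where
  "convex_fun s f \<longleftrightarrow>
     (\<forall>x \<in> carrier_vec s. \<forall>y \<in> carrier_vec s. \<forall>t. 0 \<le> t \<and> t \<le> 1 \<longrightarrow>
        f (t \<cdot>\<^sub>v x + (1 - t) \<cdot>\<^sub>v y) \<le> t * f x + (1 - t) * f y)"

definition subdifferential :: "nat \<Rightarrow> (real vec \<Rightarrow> ereal) \<Rightarrow> real vec \<Rightarrow> real vec set" where
  "subdifferential s f x =
     {g \<in> carrier_vec s. \<forall>y \<in> carrier_vec s. f x + ereal (g \<bullet> (y - x)) \<le> f y}"

definition fenchel_conj :: "nat \<Rightarrow> (real vec \<Rightarrow> ereal) \<Rightarrow> real vec \<Rightarrow> ereal" where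
  "fenchel_conj s f y = (SUP x \<in> carrier_vec s. ereal (x \<bullet> y) - f x)"

definition indicator_fun :: "real vec set \<Rightarrow> real vec \<Rightarrow> ereal" where
  "indicator_fun S x = (if x \<in> S then 0 else \<infinity>)"

definition pos_def_mats :: "nat \<Rightarrow> real mat set" where
  "pos_def_mats s = {H \<in> carrier_mat s s. H\<^sup>T = H \<and>
     (\<forall>x \<in> carrier_vec s. x \<noteq> 0\<^sub>v s \<longrightarrow> x \<bullet> (H *\<^sub>v x) > 0)}"

(* mat_inverse is option-valued; it is Some of the inverse whenever the matrix is invertible,
   in particular on pos_def_mats. *)
abbreviation inv_mat :: "real mat \<Rightarrow> real mat" where
  "inv_mat H \<equiv> the (mat_inverse H)"

(* The proximity operator is the set of minimisers. For f convex with nonempty domain and H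
   positive definite the objective is strictly convex on the domain of f, so this set has at most
   one element, and an equation w = prox_{f,H}(x) is the membership of w in it. *)
definition prox :: "nat \<Rightarrow> (real vec \<Rightarrow> ereal) \<Rightarrow> real mat \<Rightarrow> real vec \<Rightarrow> real vec set" where
  "prox s f H x =
     {w. is_arg_min (\<lambda>y. ereal (1 / 2 * ((y - x) \<bullet> (H *\<^sub>v (y - x)))) + f y)
                    (\<lambda>y. y \<in> carrier_vec s) w}"

(* Block j occupies the positions offset m j, ..., offset m (j + 1) - 1; offset m d is the total
   number of rows of d blocks. *)
definition offset :: "(nat \<Rightarrow> nat) \<Rightarrow> nat \<Rightarrow> nat" where
  "offset m j = (\<Sum>i<j. m i)"

definition block :: "(nat \<Rightarrow> nat) \<Rightarrow> nat \<Rightarrow> real vec \<Rightarrow> real vec" where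
  "block m j z = vec (m j) (\<lambda>i. z $ (offset m j + i))"

definition stack_rows :: "nat \<Rightarrow> nat \<Rightarrow> (nat \<Rightarrow> real mat) \<Rightarrow> real mat" where
  "stack_rows n d Bs = mat_of_rows n (concat (map (\<lambda>j. rows (Bs j)) [0..<d]))"

(* The matrix I'_j with N columns. *)
definition block_selector :: "(nat \<Rightarrow> nat) \<Rightarrow> nat \<Rightarrow> nat \<Rightarrow> real mat" where
  "block_selector m N j = mat (m j) N (\<lambda>(i, k). if k = offset m j + i then 1 else 0)"

definition mat_range :: "real mat \<Rightarrow> real vec set" where
  "mat_range A = (\<lambda>x. A *\<^sub>v x) ` carrier_vec (dim_col A)"

abbreviation mat_rank :: "real mat \<Rightarrow> nat" where
  "mat_rank A \<equiv> vec_space.rank (dim_row A) A"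

(* The library's orthogonal_mat only asks for pairwise orthogonal columns, not for unit ones. *)
definition orthogonal_group :: "nat \<Rightarrow> real mat set" where
  "orthogonal_group s = {U \<in> carrier_mat s s. U\<^sup>T * U = 1\<^sub>m s \<and> U * U\<^sup>T = 1\<^sub>m s}"

(* B = U * Lambda * V^T, where the nonzero singular values are sigma 0 >= ... >= sigma (r - 1) > 0
   and Lambda has the same shape as B. *)
definition is_svd ::
  "real mat \<Rightarrow> nat \<Rightarrow> real mat \<Rightarrow> (nat \<Rightarrow> real) \<Rightarrow> real mat \<Rightarrow> bool" where
  "is_svd B r U \<sigma> V \<longleftrightarrow>
     U \<in> orthogonal_group (dim_row B) \<and>
     V \<in> orthogonal_group (dim_col B) \<and>
     r = mat_rank B \<and>
     (\<forall>i<r. \<sigma> i > 0) \<and>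
     (\<forall>i j. i \<le> j \<and> j < r \<longrightarrow> \<sigma> j \<le> \<sigma> i) \<and>
     B = U * mat (dim_row B) (dim_col B) (\<lambda>(i, j). if i = j \<and> i < r then \<sigma> i else 0) * V\<^sup>T"

(* B' = V * Lambda' * U', where U' = diag(U_r^T, I_{n-r}), U_r being the first r columns of U,
   and Lambda' = diag(1 / sigma 0, ..., 1 / sigma (r - 1), 1, ..., 1). *)
definition B_prime ::
  "nat \<Rightarrow> nat \<Rightarrow> real mat \<Rightarrow> (nat \<Rightarrow> real) \<Rightarrow> real mat \<Rightarrow> real mat" where
  "B_prime n r U \<sigma> V =
     V * mat_diag n (\<lambda>i. if i < r then inverse (\<sigma> i) else 1)
       * diag_block_mat [(mat_of_cols (dim_row U) (take r (cols U)))\<^sup>T, 1\<^sub>m (n - r)]"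

definition lifted_range :: "real mat \<Rightarrow> nat \<Rightarrow> real vec set" where
  "lifted_range B k = {y @\<^sub>v v | y v. y \<in> mat_range B \<and> v \<in> carrier_vec k}"

end

theory Submission
  imports Defs
begin

text \<open>
  The three proximity equations are first-order optimality conditions in disguise. Comparing a
  minimiser with nearby points on a segment (\<open>prox_residual_in_subdifferential\<close>) shows that each of
  them is a subgradient inclusion in which the positive definite matrix has cancelled:
  \<^item> \<open>- (B'\<^sup>T a + c)\<close> is a subgradient at \<open>w\<close> of the weighted 1-norm \<open>F\<close> of the blocks;
  \<^item> \<open>u = B' w\<close> is a subgradient at \<open>a\<close> of the conjugate of \<open>\<psi>\<close>;
  \<^item> \<open>w\<close> is a subgradient at \<open>c\<close> of the support function of the subspace \<open>M\<close> of all pairs whose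
    first component lies in the range of \<open>B\<close>.

  The second inclusion inverts to: \<open>a\<close> is a subgradient of \<open>\<psi>\<close> at \<open>u\<close>
  (\<open>subdifferential_conj_inversion\<close>). The inversion needs that a finite convex function on a
  finite-dimensional space has a subgradient everywhere, which is proved by extending a linear minorant
  coordinate by coordinate as in the Hahn-Banach theorem (\<open>subgradient_exists\<close>). The third inclusion says
  that \<open>c\<close> is orthogonal to \<open>M\<close> and that \<open>w\<close> lies in \<open>M\<close>
  (\<open>fenchel_conj_indicator_finite\<close>, \<open>support_function_subgradient_in_range\<close>). Hence \<open>b\<close> lies in the
  kernel of \<open>B\<^sup>T\<close> and the tail of \<open>c\<close> vanishes. Reading the first inclusion entry by entry
  (\<open>weighted_l1_subgradient\<close>) then yields the relations between the parameters, \<open>a\<close> and \<open>b\<close>.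

  The matrix \<open>B'\<close> inverts the lifting of the problem to \<open>M\<close>. On the one hand, \<open>B (B' w) = z\<close> because
  \<open>z\<close> is in the range of \<open>B\<close> (\<open>mult_B_prime_range\<close>), so that the blocks of \<open>z\<close>, whose sparsity is known,
  are the vectors \<open>B\<^sub>j u\<close>. On the other hand, every competitor \<open>x\<close> is \<open>B' y\<close> for some \<open>y\<close> in \<open>M\<close> with
  first component \<open>B x\<close> (\<open>B_prime_surj_lift\<close>). For such \<open>y\<close> the subgradient inequality for \<open>F\<close> reads
  \<open>F y \<ge> F w - a \<bullet> (x - u)\<close>, since \<open>c\<close> is orthogonal to \<open>y - w\<close>. Adding
  \<open>\<psi> x \<ge> \<psi> u + a \<bullet> (x - u)\<close> cancels the linear terms, and \<open>u\<close> is optimal.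
\<close>

section \<open>Proximity operators and subgradients\<close>

lemma scalar_prod_self_nonneg: "0 \<le> (x :: real vec) \<bullet> x"
  unfolding scalar_prod_def by (rule sum_nonneg) simp

lemma scalar_prod_self_eq_0:
  fixes x :: "real vec"
  assumes x: "x \<in> carrier_vec n"
  shows "x \<bullet> x = 0 \<longleftrightarrow> x = 0\<^sub>v n"
proof
  assume "x \<bullet> x = 0"
  then have "\<forall>i \<in> {0..<n}. x $ i * x $ i = 0"
    using x unfolding scalar_prod_def by (subst (asm) sum_nonneg_eq_0_iff) auto
  then show "x = 0\<^sub>v n" using x by (intro eq_vecI) auto
qed simp

lemma quadratic_form_add_smult:
  fixes H :: "real mat"
  assumes H: "H \<in> carrier_mat s s" and sym: "H\<^sup>T = H"
    and x: "x \<in> carrier_vec s" and y: "y \<in> carrier_vec s"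
  shows "(x + t \<cdot>\<^sub>v y) \<bullet> (H *\<^sub>v (x + t \<cdot>\<^sub>v y))
       = x \<bullet> (H *\<^sub>v x) + 2 * t * ((H *\<^sub>v x) \<bullet> y) + t\<^sup>2 * (y \<bullet> (H *\<^sub>v y))"
proof -
  have [simp]: "H *\<^sub>v x \<in> carrier_vec s" "H *\<^sub>v y \<in> carrier_vec s" using H x y by auto
  have cross: "x \<bullet> (H *\<^sub>v y) = (H *\<^sub>v x) \<bullet> y"
    using transpose_vec_mult_scalar[OF H y x] sym by simp
  have cross': "y \<bullet> (H *\<^sub>v x) = (H *\<^sub>v x) \<bullet> y"
    by (rule comm_scalar_prod[of _ s]) (use x y in auto)
  have "H *\<^sub>v (x + t \<cdot>\<^sub>v y) = H *\<^sub>v x + t \<cdot>\<^sub>v (H *\<^sub>v y)"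
    using H x y by (simp add: mult_add_distrib_mat_vec[OF H] mult_mat_vec[OF H])
  then show ?thesis
    using x y
    by (simp add: scalar_prod_add_distrib[of _ s] add_scalar_prod_distrib[of _ s] cross cross'
        power2_eq_square algebra_simps)
qed

text \<open>
  Dividing by \<open>t\<close> and letting \<open>t\<close> tend to zero discards the quadratic
  term. This is where first-order optimality comes out of comparing a minimiser with points on a
  segment.
\<close>

lemma linear_term_nonneg:
  fixes A Q :: real
  assumes "\<And>t. 0 < t \<Longrightarrow> t < 1 \<Longrightarrow> 0 \<le> t * A + t\<^sup>2 * Q"
  shows "0 \<le> A"
proof (rule tendsto_lowerbound[where F = "at_right 0" and f = "\<lambda>t. A + t * Q"])
  have "((\<lambda>t. A + t * Q) \<longlongrightarrow> A + 0 * Q) (at_right 0)" by (intro tendsto_intros)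
  then show "((\<lambda>t. A + t * Q) \<longlongrightarrow> A) (at_right 0)" by simp
  have "0 \<le> A + t * Q" if "0 < t" "t < 1" for t
  proof -
    have "0 \<le> t * (A + t * Q)" using assms[OF that] by (simp add: power2_eq_square algebra_simps)
    with that show ?thesis by (simp add: zero_le_mult_iff)
  qed
  then show "\<forall>\<^sub>F t in at_right 0. 0 \<le> A + t * Q"
    by (auto simp: eventually_at_right_field intro!: exI[of _ 1])
qed simp

text \<open>
  Convexity tested only between points with finite values. This avoids the products and sums of
  infinities that the usual inequality would involve, and it says as much as the usual inequality,
  which is trivial when one of the values is \<open>\<infinity>\<close>, as long as
  \<open>-\<infinity>\<close> is not a value.
\<close>

definition convex_ereal_fun :: "nat \<Rightarrow> (real vec \<Rightarrow> ereal) \<Rightarrow> bool" where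
  "convex_ereal_fun s f \<longleftrightarrow>
     (\<forall>x \<in> carrier_vec s. \<forall>y \<in> carrier_vec s. \<forall>t \<alpha> \<beta>. 0 < t \<and> t < 1 \<longrightarrow>
        f x = ereal \<alpha> \<longrightarrow> f y = ereal \<beta> \<longrightarrow>
        f (t \<cdot>\<^sub>v x + (1 - t) \<cdot>\<^sub>v y) \<le> ereal (t * \<alpha> + (1 - t) * \<beta>))"

lemma convex_ereal_fun_ereal:
  "convex_fun s f \<Longrightarrow> convex_ereal_fun s (\<lambda>x. ereal (f x))"
  unfolding convex_fun_def convex_ereal_fun_def by auto

lemma prox_cong:
  assumes eq: "\<And>y. y \<in> carrier_vec s \<Longrightarrow> f y = g y" and w: "w \<in> prox s f H x"
  shows "w \<in> prox s g H x"
  using w eq unfolding prox_def is_arg_min_def by (auto simp: eq)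

text \<open>
  If the minimiser had value \<open>\<infinity>\<close>, the point \<open>y0\<close> would be
  strictly better.
\<close>

lemma prox_value_finite:
  assumes w: "w \<in> prox s f H x"
    and proper: "\<And>y. y \<in> carrier_vec s \<Longrightarrow> f y \<noteq> -\<infinity>"
    and y0: "y0 \<in> carrier_vec s" "f y0 \<noteq> \<infinity>"
  shows "w \<in> carrier_vec s" "\<exists>\<phi>. f w = ereal \<phi>"
proof -
  show wc: "w \<in> carrier_vec s" using w by (auto simp: prox_def is_arg_min_def)
  have "\<not> ereal (1 / 2 * ((y0 - x) \<bullet> (H *\<^sub>v (y0 - x)))) + f y0
      < ereal (1 / 2 * ((w - x) \<bullet> (H *\<^sub>v (w - x)))) + f w"
    using w y0 by (auto simp: prox_def is_arg_min_def)
  then have "f w \<noteq> \<infinity>" using y0 proper[OF y0(1)]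
    by (cases "f y0") auto
  with proper[OF wc] show "\<exists>\<phi>. f w = ereal \<phi>" by (cases "f w") auto
qed

text \<open>
  The first-order condition for the proximity operator. Comparing \<open>w\<close> with the points
  \<open>w + t (y - w)\<close> of the segment towards a competitor \<open>y\<close> gives an
  inequality whose terms of first order in \<open>t\<close> are exactly the subgradient
  inequality; the metric \<open>H\<close> survives only through the residual.
\<close>

lemma prox_residual_in_subdifferential:
  assumes H: "H \<in> pos_def_mats s" and cvx: "convex_ereal_fun s f"
    and proper: "\<And>y. y \<in> carrier_vec s \<Longrightarrow> f y \<noteq> -\<infinity>"
    and x: "x \<in> carrier_vec s" and w: "w \<in> prox s f H x" and fw: "f w = ereal \<phi>"
  shows "H *\<^sub>v (x - w) \<in> subdifferential s f w"
proof -
  have Hc: "H \<in> carrier_mat s s" and sym: "H\<^sup>T = H" using H by (auto simp: pos_def_mats_def)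
  have wc: "w \<in> carrier_vec s" using w by (auto simp: prox_def is_arg_min_def)
  have "f w + ereal ((H *\<^sub>v (x - w)) \<bullet> (y - w)) \<le> f y" if y: "y \<in> carrier_vec s" for y
  proof (cases "f y")
    case (real \<eta>)
    let ?e = "w - x" and ?h = "y - w"
    have ec: "?e \<in> carrier_vec s" and hc: "?h \<in> carrier_vec s" using wc x y by auto
    have "0 \<le> t * ((H *\<^sub>v ?e) \<bullet> ?h + (\<eta> - \<phi>)) + t\<^sup>2 * (1/2 * (?h \<bullet> (H *\<^sub>v ?h)))"
      if t: "0 < t" "t < 1" for t
    proof -
      let ?p = "t \<cdot>\<^sub>v y + (1 - t) \<cdot>\<^sub>v w"
      have pc: "?p \<in> carrier_vec s" using y wc by auto
      have px: "?p - x = ?e + t \<cdot>\<^sub>v ?h"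
        by (rule eq_vecI) (use y wc x in \<open>auto simp: algebra_simps\<close>)
      have fp: "f ?p \<le> ereal (t * \<eta> + (1 - t) * \<phi>)"
        using cvx y wc real fw t unfolding convex_ereal_fun_def by blast
      then obtain \<pi> where \<pi>: "f ?p = ereal \<pi>" "\<pi> \<le> t * \<eta> + (1 - t) * \<phi>"
        using proper[OF pc] by (cases "f ?p") auto
      have "\<not> ereal (1 / 2 * ((?p - x) \<bullet> (H *\<^sub>v (?p - x)))) + f ?p
          < ereal (1 / 2 * (?e \<bullet> (H *\<^sub>v ?e))) + f w"
        using w pc unfolding prox_def is_arg_min_def by blast
      then have "1/2 * (?e \<bullet> (H *\<^sub>v ?e)) + \<phi> \<le> 1/2 * ((?p - x) \<bullet> (H *\<^sub>v (?p - x))) + \<pi>"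
        by (simp add: \<pi> fw not_less)
      with \<pi>(2) show ?thesis
        unfolding px quadratic_form_add_smult[OF Hc sym ec hc] by (simp add: algebra_simps)
    qed
    then have "0 \<le> (H *\<^sub>v ?e) \<bullet> ?h + (\<eta> - \<phi>)" by (rule linear_term_nonneg)
    moreover have "H *\<^sub>v (x - w) = - (H *\<^sub>v ?e)"
    proof -
      have "H *\<^sub>v (x - w) = H *\<^sub>v x - H *\<^sub>v w" "H *\<^sub>v ?e = H *\<^sub>v w - H *\<^sub>v x"
        using mult_minus_distrib_mat_vec[OF Hc] x wc by auto
      then show ?thesis by (intro eq_vecI) (use Hc in auto)
    qed
    moreover have "(- (H *\<^sub>v ?e)) \<bullet> ?h = - ((H *\<^sub>v ?e) \<bullet> ?h)"
      by (rule scalar_prod_uminus_left) (use Hc wc y in auto)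
    ultimately show ?thesis by (simp add: fw real)
  qed (use proper[OF y] in auto)
  then show ?thesis using Hc x wc by (auto simp: subdifferential_def)
qed

text \<open>
  A positive definite matrix has a trivial kernel, so its determinant does not vanish and
  Gauss-Jordan elimination succeeds.
\<close>

lemma pos_def_inverse:
  assumes H: "H \<in> pos_def_mats s"
  shows "inv_mat H \<in> carrier_mat s s" and "H * inv_mat H = 1\<^sub>m s"
proof -
  have Hc: "H \<in> carrier_mat s s" using H by (auto simp: pos_def_mats_def)
  have "det H \<noteq> 0"
  proof
    assume "det H = 0"
    then obtain x where "x \<in> carrier_vec s" "x \<noteq> 0\<^sub>v s" "H *\<^sub>v x = 0\<^sub>v s"
      using det_0_iff_vec_prod_zero[OF Hc] by auto
    moreover from this have "x \<bullet> (H *\<^sub>v x) > 0" using H by (auto simp: pos_def_mats_def)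
    ultimately show False by simp
  qed
  then have "H \<in> Units (ring_mat TYPE(real) s ())" by (rule det_non_zero_imp_unit[OF Hc])
  then obtain G where G: "mat_inverse H = Some G"
    using mat_inverse(1)[OF Hc, of "()"] by (cases "mat_inverse H") auto
  then show "inv_mat H \<in> carrier_mat s s" "H * inv_mat H = 1\<^sub>m s"
    using mat_inverse(2)[OF Hc G] by auto
qed

lemma pos_def_mult_inverse_vec:
  assumes H: "H \<in> pos_def_mats s" and x: "x \<in> carrier_vec s"
  shows "inv_mat H *\<^sub>v x \<in> carrier_vec s" and "H *\<^sub>v (inv_mat H *\<^sub>v x) = x"
proof -
  have Hc: "H \<in> carrier_mat s s" using H by (auto simp: pos_def_mats_def)
  show "inv_mat H *\<^sub>v x \<in> carrier_vec s" using pos_def_inverse(1)[OF H] x by auto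
  show "H *\<^sub>v (inv_mat H *\<^sub>v x) = x"
    using assoc_mult_mat_vec[OF Hc pos_def_inverse(1)[OF H] x] pos_def_inverse(2)[OF H] x by simp
qed

lemma fenchel_conj_upper:
  assumes "x \<in> carrier_vec s" shows "ereal (x \<bullet> y) - f x \<le> fenchel_conj s f y"
  unfolding fenchel_conj_def using assms by (rule SUP_upper)

text \<open>
  A conjugate is a supremum of affine functions, so each of its affine minorants satisfies the
  convexity inequality with equality.
\<close>

lemma convex_fenchel_conj: "convex_ereal_fun s (fenchel_conj s f)"
  unfolding convex_ereal_fun_def
proof (intro ballI allI impI)
  fix x y t \<alpha> \<beta>
  assume x: "x \<in> carrier_vec s" and y: "y \<in> carrier_vec s" and t: "0 < t \<and> t < (1::real)"
    and fx: "fenchel_conj s f x = ereal \<alpha>" and fy: "fenchel_conj s f y = ereal \<beta>"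
  show "fenchel_conj s f (t \<cdot>\<^sub>v x + (1 - t) \<cdot>\<^sub>v y) \<le> ereal (t * \<alpha> + (1 - t) * \<beta>)"
    unfolding fenchel_conj_def
  proof (rule SUP_least)
    fix q :: "real vec" assume q: "q \<in> carrier_vec s"
    have 1: "ereal (q \<bullet> x) - f q \<le> ereal \<alpha>" using fenchel_conj_upper[OF q, of x f] fx by simp
    have 2: "ereal (q \<bullet> y) - f q \<le> ereal \<beta>" using fenchel_conj_upper[OF q, of y f] fy by simp
    show "ereal (q \<bullet> (t \<cdot>\<^sub>v x + (1 - t) \<cdot>\<^sub>v y)) - f q \<le> ereal (t * \<alpha> + (1 - t) * \<beta>)"
    proof (cases "f q")
      case (real \<gamma>)
      have "t * (q \<bullet> x - \<gamma>) + (1 - t) * (q \<bullet> y - \<gamma>) \<le> t * \<alpha> + (1 - t) * \<beta>"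
        using 1 2 t by (intro add_mono mult_left_mono) (auto simp: real)
      moreover have "q \<bullet> (t \<cdot>\<^sub>v x + (1 - t) \<cdot>\<^sub>v y) = t * (q \<bullet> x) + (1 - t) * (q \<bullet> y)"
        using q x y by (simp add: scalar_prod_add_distrib[of _ s])
      ultimately show ?thesis by (simp add: real algebra_simps)
    qed (use 1 in auto)
  qed
qed

text \<open>
  For a conjugate function and a base point of the form \<open>H\<^sup>-\<^sup>1 q + a\<close>,
  the residual is \<open>q\<close> itself, so the choice of \<open>H\<close> disappears. The point
  \<open>x0\<close> keeps the conjugate away from \<open>-\<infinity>\<close>, and
  \<open>y0\<close> shows that it is not constantly \<open>\<infinity>\<close>.
\<close>

lemma prox_conj_subdifferential:
  assumes H: "H \<in> pos_def_mats s" and q: "q \<in> carrier_vec s"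
    and a: "a \<in> prox s (fenchel_conj s f) H (inv_mat H *\<^sub>v q + a)"
    and x0: "x0 \<in> carrier_vec s" "f x0 = ereal \<phi>"
    and y0: "y0 \<in> carrier_vec s" "fenchel_conj s f y0 \<noteq> \<infinity>"
  shows "q \<in> subdifferential s (fenchel_conj s f) a"
    and "\<exists>\<alpha>. fenchel_conj s f a = ereal \<alpha>"
proof -
  have Hc: "H \<in> carrier_mat s s" using H by (auto simp: pos_def_mats_def)
  have proper: "fenchel_conj s f y \<noteq> -\<infinity>" for y
    using fenchel_conj_upper[OF x0(1), of y f] x0(2) by auto
  note fin = prox_value_finite[OF a proper y0]
  have Hq: "inv_mat H *\<^sub>v q \<in> carrier_vec s" by (rule pos_def_mult_inverse_vec(1)[OF H q])
  show "\<exists>\<alpha>. fenchel_conj s f a = ereal \<alpha>" by (rule fin(2))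
  then obtain \<alpha> where \<alpha>: "fenchel_conj s f a = ereal \<alpha>" ..
  have "inv_mat H *\<^sub>v q + a \<in> carrier_vec s" using Hq fin(1) by simp
  from prox_residual_in_subdifferential[OF H convex_fenchel_conj proper this a \<alpha>]
  have "H *\<^sub>v ((inv_mat H *\<^sub>v q + a) - a) \<in> subdifferential s (fenchel_conj s f) a" .
  moreover have "x + a - a = x" if "x \<in> carrier_vec s" for x
    by (rule eq_vecI) (use that fin(1) in auto)
  note this[OF Hq]
  ultimately show "q \<in> subdifferential s (fenchel_conj s f) a"
    using pos_def_mult_inverse_vec(2)[OF H q] by simp
qed

section \<open>Subgradients of finite convex functions\<close>

text \<open>
  The combination of \<open>h + t e\<close> and \<open>h' - s e\<close> with weights proportional
  to \<open>s\<close> and \<open>t\<close> cancels the direction \<open>e\<close>. In the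
  extension step below this is what keeps the lower bounds for the new coefficient beneath the
  upper ones.
\<close>

lemma convex_fun_exchange:
  fixes f :: "real vec \<Rightarrow> real"
  assumes cvx: "convex_fun n f" and u: "u \<in> carrier_vec n" and e: "e \<in> carrier_vec n"
    and h: "h \<in> carrier_vec n" "h' \<in> carrier_vec n" and st: "0 < s" "0 < t"
  shows "(s + t) * f (u + (1 / (s + t)) \<cdot>\<^sub>v (s \<cdot>\<^sub>v h + t \<cdot>\<^sub>v h'))
       \<le> s * f (u + (h + t \<cdot>\<^sub>v e)) + t * f (u + (h' - s \<cdot>\<^sub>v e))"
proof -
  let ?q = "s / (s + t)"
  have q: "0 \<le> ?q" "?q \<le> 1" "1 - ?q = t / (s + t)" using st by (auto simp: field_simps)
  have "u + (1 / (s + t)) \<cdot>\<^sub>v (s \<cdot>\<^sub>v h + t \<cdot>\<^sub>v h')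
      = ?q \<cdot>\<^sub>v (u + (h + t \<cdot>\<^sub>v e)) + (1 - ?q) \<cdot>\<^sub>v (u + (h' - s \<cdot>\<^sub>v e))"
    unfolding q(3)
  proof (rule eq_vecI)
    fix i assume "i < dim_vec ((s / (s + t)) \<cdot>\<^sub>v (u + (h + t \<cdot>\<^sub>v e)) + (t / (s + t)) \<cdot>\<^sub>v (u + (h' - s \<cdot>\<^sub>v e)))"
    then have i: "i < n" using u e h by simp
    have "u $ i + (s * h $ i + t * h' $ i) / (s + t)
        = (s * (u $ i + (h $ i + t * e $ i)) + t * (u $ i + (h' $ i - s * e $ i))) / (s + t)"
      using st by (simp add: field_simps)
    then show "(u + (1 / (s + t)) \<cdot>\<^sub>v (s \<cdot>\<^sub>v h + t \<cdot>\<^sub>v h')) $ i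
        = ((s / (s + t)) \<cdot>\<^sub>v (u + (h + t \<cdot>\<^sub>v e)) + (t / (s + t)) \<cdot>\<^sub>v (u + (h' - s \<cdot>\<^sub>v e))) $ i"
      using i u e h by (simp add: add_divide_distrib)
  qed (use u e h in auto)
  moreover have "f (?q \<cdot>\<^sub>v (u + (h + t \<cdot>\<^sub>v e)) + (1 - ?q) \<cdot>\<^sub>v (u + (h' - s \<cdot>\<^sub>v e)))
      \<le> ?q * f (u + (h + t \<cdot>\<^sub>v e)) + (1 - ?q) * f (u + (h' - s \<cdot>\<^sub>v e))"
    by (rule cvx[unfolded convex_fun_def, rule_format]) (use u e h q(1,2) in auto)
  ultimately have "f (u + (1 / (s + t)) \<cdot>\<^sub>v (s \<cdot>\<^sub>v h + t \<cdot>\<^sub>v h'))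
      \<le> ?q * f (u + (h + t \<cdot>\<^sub>v e)) + (1 - ?q) * f (u + (h' - s \<cdot>\<^sub>v e))"
    by simp
  then have "(s + t) * f (u + (1 / (s + t)) \<cdot>\<^sub>v (s \<cdot>\<^sub>v h + t \<cdot>\<^sub>v h'))
      \<le> (s + t) * (?q * f (u + (h + t \<cdot>\<^sub>v e)) + (1 - ?q) * f (u + (h' - s \<cdot>\<^sub>v e)))"
    using st by (intro mult_left_mono) auto
  also have "\<dots> = ((s + t) * ?q) * f (u + (h + t \<cdot>\<^sub>v e))
      + ((s + t) * (1 - ?q)) * f (u + (h' - s \<cdot>\<^sub>v e))" by (simp only: distrib_left mult.assoc)
  also have "(s + t) * ?q = s" using st by simp
  also have "(s + t) * (1 - ?q) = t" unfolding q(3) using st by simp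
  finally show ?thesis .
qed

text \<open>
  A finite-dimensional Hahn-Banach argument. A vector that is a subgradient for displacements
  supported on the first \<open>k\<close> coordinates is extended by one coordinate at a time.
  Displacements with a positive entry in position \<open>k\<close> bound the new coefficient from
  above and those with a negative entry bound it from below; by the exchange inequality every
  lower bound is at most every upper bound, so the supremum of the lower bounds is an admissible
  coefficient.
\<close>

lemma subgradient_exists_on_coordinate_subspace:
  fixes f :: "real vec \<Rightarrow> real"
  assumes cvx: "convex_fun n f" and u: "u \<in> carrier_vec n" and "k \<le> n"
  shows "\<exists>g \<in> carrier_vec n. \<forall>h \<in> carrier_vec n.
           (\<forall>i. k \<le> i \<and> i < n \<longrightarrow> h $ i = 0) \<longrightarrow> f u + g \<bullet> h \<le> f (u + h)"
  using \<open>k \<le> n\<close>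
proof (induction k)
  case 0
  have "h = 0\<^sub>v n" if "h \<in> carrier_vec n" "\<forall>i. 0 \<le> i \<and> i < n \<longrightarrow> h $ i = 0" for h :: "real vec"
    using that by (intro eq_vecI) auto
  then have "f u + 0\<^sub>v n \<bullet> h \<le> f (u + h)"
    if "h \<in> carrier_vec n" "\<forall>i. 0 \<le> i \<and> i < n \<longrightarrow> h $ i = 0" for h :: "real vec"
    using that u by fastforce
  then show ?case by (intro bexI[of _ "0\<^sub>v n"]) auto
next
  case (Suc k)
  then have k: "k < n" by simp
  define S :: "real vec set" where
    "S = {h \<in> carrier_vec n. \<forall>i. k \<le> i \<and> i < n \<longrightarrow> h $ i = 0}"
  have Sc: "h \<in> carrier_vec n" if "h \<in> S" for h using that by (simp add: S_def)
  obtain g where g: "g \<in> carrier_vec n"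
    and gS: "\<And>h. h \<in> S \<Longrightarrow> f u + g \<bullet> h \<le> f (u + h)"
    using Suc k by (force simp: S_def)
  let ?e = "unit_vec n k :: real vec"
  define lower where "lower = (\<lambda>(h, s). (f u + g \<bullet> h - f (u + (h - s \<cdot>\<^sub>v ?e))) / s)"
  define upper where "upper = (\<lambda>(h, t). (f (u + (h + t \<cdot>\<^sub>v ?e)) - f u - g \<bullet> h) / t)"
  have le: "lower (h', s) \<le> upper (h, t)"
    if h: "h \<in> S" "h' \<in> S" and st: "0 < s" "0 < t" for h h' s t
  proof -
    let ?c = "(1 / (s + t)) \<cdot>\<^sub>v (s \<cdot>\<^sub>v h + t \<cdot>\<^sub>v h')"
    have cS: "?c \<in> S" using h by (auto simp: S_def)
    have "(s + t) * (g \<bullet> ?c) = s * (g \<bullet> h) + t * (g \<bullet> h')"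
      using g Sc[OF h(1)] Sc[OF h(2)] st
      by (simp add: scalar_prod_add_distrib[of _ n])
    moreover have "(s + t) * (f u + g \<bullet> ?c) \<le> (s + t) * f (u + ?c)"
      using gS[OF cS] st by (intro mult_left_mono) auto
    moreover note convex_fun_exchange[OF cvx u _ Sc[OF h(1)] Sc[OF h(2)] st, of ?e]
    ultimately have "s * (f u + g \<bullet> h) + t * (f u + g \<bullet> h')
        \<le> s * f (u + (h + t \<cdot>\<^sub>v ?e)) + t * f (u + (h' - s \<cdot>\<^sub>v ?e))"
      by (simp add: algebra_simps)
    then show ?thesis using st by (simp add: lower_def upper_def field_simps)
  qed
  have zS: "0\<^sub>v n \<in> S" by (simp add: S_def)
  define \<alpha> where "\<alpha> = Sup (lower ` (S \<times> {0<..}))"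
  have bdd: "bdd_above (lower ` (S \<times> {0<..}))"
    by (rule bdd_aboveI[of _ "upper (0\<^sub>v n, 1)"]) (use le[OF zS] in auto)
  have lower_\<alpha>: "lower (h, s) \<le> \<alpha>" if "h \<in> S" "0 < s" for h s
    unfolding \<alpha>_def by (rule cSup_upper[OF _ bdd]) (use that in auto)
  have \<alpha>_upper: "\<alpha> \<le> upper (h, t)" if "h \<in> S" "0 < t" for h t
    unfolding \<alpha>_def by (rule cSup_least) (use zS that le in \<open>auto intro!: exI[of _ 1]\<close>)
  define g' where "g' = g + (\<alpha> - g $ k) \<cdot>\<^sub>v ?e"
  show ?case
  proof (intro bexI[of _ g'] ballI impI)
    show "g' \<in> carrier_vec n" using g by (simp add: g'_def)
    fix h :: "real vec"
    assume h: "h \<in> carrier_vec n" and h0: "\<forall>i. Suc k \<le> i \<and> i < n \<longrightarrow> h $ i = 0"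
    (* Remove the new coordinate, so that the induction hypothesis applies to what remains. *)
    define q where "q = h - h $ k \<cdot>\<^sub>v ?e"
    have qc: "q \<in> carrier_vec n" using h by (simp add: q_def)
    have "q $ i = 0" if "k \<le> i" "i < n" for i
      using that h0 h k by (cases "i = k") (auto simp: q_def)
    then have qS: "q \<in> S" using qc by (simp add: S_def)
    have hq: "h = q + h $ k \<cdot>\<^sub>v ?e" by (rule eq_vecI) (use h in \<open>auto simp: q_def\<close>)
    have "g' \<bullet> h = g \<bullet> h + (\<alpha> - g $ k) * h $ k"
      using g h k by (simp add: g'_def add_scalar_prod_distrib[of _ n])
    moreover have "g \<bullet> h = g \<bullet> q + h $ k * g $ k"
      using g k qc by (subst hq) (simp add: scalar_prod_add_distrib[of _ n])
    ultimately have g'h: "g' \<bullet> h = g \<bullet> q + \<alpha> * h $ k" by (simp add: algebra_simps)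
    consider "h $ k = 0" | "h $ k > 0" | "h $ k < 0" by linarith
    then show "f u + g' \<bullet> h \<le> f (u + h)"
    proof cases
      case 1
      then have "h = q" using hq h qc by (intro eq_vecI) (auto simp: q_def)
      then show ?thesis using gS[OF qS] g'h 1 by simp
    next
      case 2
      have "\<alpha> * h $ k \<le> f (u + h) - f u - g \<bullet> q"
        using \<alpha>_upper[OF qS 2] hq 2 by (simp add: upper_def field_simps)
      then show ?thesis using g'h by simp
    next
      case 3
      have "q - (- (h $ k)) \<cdot>\<^sub>v ?e = h" by (rule eq_vecI) (use h in \<open>auto simp: q_def\<close>)
      then have "f u + g \<bullet> q - f (u + h) \<le> \<alpha> * - (h $ k)"
        using lower_\<alpha>[OF qS, of "- (h $ k)"] 3 by (simp add: lower_def field_simps)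
      then show ?thesis using g'h by simp
    qed
  qed
qed

lemma subgradient_exists:
  fixes f :: "real vec \<Rightarrow> real"
  assumes "convex_fun n f" and u: "u \<in> carrier_vec n"
  obtains g where "g \<in> subdifferential n (\<lambda>x. ereal (f x)) u"
proof -
  obtain g where g: "g \<in> carrier_vec n"
    and sub: "\<And>h. h \<in> carrier_vec n \<Longrightarrow> f u + g \<bullet> h \<le> f (u + h)"
    using subgradient_exists_on_coordinate_subspace[OF assms order_refl] by auto
  have "f u + g \<bullet> (y - u) \<le> f y" if "y \<in> carrier_vec n" for y
  proof -
    have "u + (y - u) = y" by (rule eq_vecI) (use u that in auto)
    then show ?thesis using sub[of "y - u"] u that by simp
  qed
  then show thesis using that g by (auto simp: subdifferential_def)
qed

text \<open>
  Equality in the Fenchel-Young inequality: the subgradient inequality says that the supremum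
  defining the conjugate at \<open>g\<close> is attained at \<open>u\<close>.
\<close>

lemma fenchel_conj_at_subgradient:
  fixes f :: "real vec \<Rightarrow> real"
  assumes u: "u \<in> carrier_vec n" and g: "g \<in> subdifferential n (\<lambda>x. ereal (f x)) u"
  shows "fenchel_conj n (\<lambda>x. ereal (f x)) g = ereal (u \<bullet> g - f u)"
proof (rule antisym)
  have gc: "g \<in> carrier_vec n" using g by (simp add: subdifferential_def)
  show "fenchel_conj n (\<lambda>x. ereal (f x)) g \<le> ereal (u \<bullet> g - f u)"
    unfolding fenchel_conj_def
  proof (rule SUP_least)
    fix x :: "real vec" assume x: "x \<in> carrier_vec n"
    have "f u + g \<bullet> (x - u) \<le> f x" using g x by (auto simp: subdifferential_def)
    then show "ereal (x \<bullet> g) - ereal (f x) \<le> ereal (u \<bullet> g - f u)"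
      using x u gc by (simp add: scalar_prod_minus_distrib[of _ n] comm_scalar_prod[of g n])
  qed
  show "ereal (u \<bullet> g - f u) \<le> fenchel_conj n (\<lambda>x. ereal (f x)) g"
    using fenchel_conj_upper[OF u, of g "\<lambda>x. ereal (f x)"] by simp
qed

text \<open>
  The part of the Fenchel-Moreau theorem that turns a subgradient of the conjugate into a
  subgradient of the function. Let \<open>g\<close> be any subgradient of \<open>f\<close> at
  \<open>u\<close>. Testing the hypothesis on \<open>u\<close> at \<open>g\<close>, where the
  value of the conjugate is known, gives \<open>f u + f\<^sup>* a \<le> u \<bullet> a\<close>, and
  with the Fenchel-Young inequality at every other point this is the claim.
\<close>

lemma subdifferential_conj_inversion:
  fixes f :: "real vec \<Rightarrow> real"
  assumes cvx: "convex_fun n f" and a: "a \<in> carrier_vec n"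
    and fin: "fenchel_conj n (\<lambda>x. ereal (f x)) a = ereal \<alpha>"
    and u: "u \<in> subdifferential n (fenchel_conj n (\<lambda>x. ereal (f x))) a"
  shows "a \<in> subdifferential n (\<lambda>x. ereal (f x)) u"
proof -
  have uc: "u \<in> carrier_vec n" using u by (simp add: subdifferential_def)
  obtain g where g: "g \<in> subdifferential n (\<lambda>x. ereal (f x)) u"
    using subgradient_exists[OF cvx uc] .
  then have gc: "g \<in> carrier_vec n" by (simp add: subdifferential_def)
  have "ereal \<alpha> + ereal (u \<bullet> (g - a)) \<le> ereal (u \<bullet> g - f u)"
    using u gc by (auto simp: subdifferential_def fin fenchel_conj_at_subgradient[OF uc g, symmetric])
  then have young: "f u + \<alpha> \<le> u \<bullet> a"
    using uc gc a by (simp add: scalar_prod_minus_distrib[of _ n])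
  have "f u + a \<bullet> (x - u) \<le> f x" if x: "x \<in> carrier_vec n" for x
  proof -
    have "x \<bullet> a - f x \<le> \<alpha>"
      using fenchel_conj_upper[OF x, of a "\<lambda>x. ereal (f x)"] by (simp add: fin)
    with young show ?thesis
      using x uc a by (simp add: scalar_prod_minus_distrib[of _ n] comm_scalar_prod[of a n])
  qed
  then show ?thesis using a by (auto simp: subdifferential_def)
qed

lemma fenchel_conj_indicator_orthogonal:
  assumes M: "M \<subseteq> carrier_vec s" "M \<noteq> {}" and orth: "\<And>x. x \<in> M \<Longrightarrow> x \<bullet> c = 0"
  shows "fenchel_conj s (indicator_fun M) c = 0"
proof (rule antisym)
  show "fenchel_conj s (indicator_fun M) c \<le> 0"
    unfolding fenchel_conj_def
    by (rule SUP_least) (use orth in \<open>auto simp: indicator_fun_def zero_ereal_def\<close>)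
  obtain x where x: "x \<in> M" using M by auto
  then show "0 \<le> fenchel_conj s (indicator_fun M) c"
    using fenchel_conj_upper[of x s c "indicator_fun M"] M orth
    by (auto simp: indicator_fun_def zero_ereal_def)
qed

text \<open>
  On a set closed under scaling, a linear function that is bounded above must vanish.
\<close>

lemma fenchel_conj_indicator_finite:
  assumes M: "M \<subseteq> carrier_vec s" and scale: "\<And>t x. x \<in> M \<Longrightarrow> t \<cdot>\<^sub>v x \<in> M"
    and c: "c \<in> carrier_vec s"
    and fin: "fenchel_conj s (indicator_fun M) c = ereal \<alpha>" and x: "x \<in> M"
  shows "x \<bullet> c = 0"
proof (rule ccontr)
  assume ne: "x \<bullet> c \<noteq> 0"
  (* Scaled so that the linear function exceeds its bound by one. *)
  let ?t = "(\<alpha> + 1) / (x \<bullet> c)"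
  have "?t \<cdot>\<^sub>v x \<in> M" using scale[OF x] .
  then have "(?t \<cdot>\<^sub>v x) \<bullet> c \<le> \<alpha>"
    using fenchel_conj_upper[of "?t \<cdot>\<^sub>v x" s c "indicator_fun M"] M fin
    by (auto simp: indicator_fun_def)
  moreover have "(?t \<cdot>\<^sub>v x) \<bullet> c = \<alpha> + 1"
    using x M c ne by (subst smult_scalar_prod_distrib[of _ s]) auto
  ultimately show False by simp
qed

section \<open>Block structure and the weighted 1-norm\<close>

lemma offset_Suc: "offset m (Suc j) = offset m j + m j"
  by (simp add: offset_def)

lemma offset_mono: "i \<le> j \<Longrightarrow> offset m i \<le> offset m j"
  unfolding offset_def by (rule sum_mono2) auto

lemma offset_add_less:
  assumes "j < j'" "i < m j" shows "offset m j + i < offset m j'"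
  using offset_mono[of "Suc j" j' m] assms by (simp add: offset_Suc)

text \<open>
  Positions in different blocks never coincide, so a perturbation of a single entry touches a
  single block.
\<close>

lemma offset_add_eq_iff:
  assumes "i < m j" "i' < m j'"
  shows "offset m j + i = offset m j' + i' \<longleftrightarrow> j = j' \<and> i = i'"
  using offset_add_less[of j j' i m] offset_add_less[of j' j i' m] assms
  by (cases j j' rule: linorder_cases) auto

lemma length_concat_blocks:
  "(\<And>j. j < d \<Longrightarrow> length (xs j) = m j) \<Longrightarrow> length (concat (map xs [0..<d])) = offset m d"
  by (induction d) (auto simp: offset_Suc, simp add: offset_def)

lemma nth_concat_blocks:
  assumes "\<And>j. j < d \<Longrightarrow> length (xs j) = m j" "j < d" "i < m j"
  shows "concat (map xs [0..<d]) ! (offset m j + i) = xs j ! i"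
  using assms
proof (induction d)
  case (Suc d)
  have len: "length (concat (map xs [0..<d])) = offset m d"
    by (rule length_concat_blocks) (use Suc.prems in auto)
  show ?case
  proof (cases "j = d")
    case True
    then show ?thesis by (simp add: nth_append len)
  next
    case False
    then have "j < d" using Suc.prems by simp
    then show ?thesis
      using Suc.IH Suc.prems offset_add_less[of j d i m] by (simp add: nth_append len)
  qed
qed simp

lemma stack_rows_carrier:
  assumes "\<And>j. j < d \<Longrightarrow> Bs j \<in> carrier_mat (m j) n"
  shows "stack_rows n d Bs \<in> carrier_mat (offset m d) n"
proof -
  have "length (rows (Bs j)) = m j" if "j < d" for j using assms[OF that] by simp
  then have "length (concat (map (\<lambda>j. rows (Bs j)) [0..<d])) = offset m d"
    by (rule length_concat_blocks)
  then show ?thesis unfolding stack_rows_def by (metis mat_of_rows_carrier(1))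
qed

lemma block_stack_rows:
  assumes Bs: "\<And>j. j < d \<Longrightarrow> Bs j \<in> carrier_mat (m j) n" and j: "j < d"
  shows "block m j (stack_rows n d Bs *\<^sub>v x) = Bs j *\<^sub>v x"
proof (rule eq_vecI)
  show "dim_vec (block m j (stack_rows n d Bs *\<^sub>v x)) = dim_vec (Bs j *\<^sub>v x)"
    using Bs[OF j] by (simp add: block_def)
  fix i assume "i < dim_vec (Bs j *\<^sub>v x)"
  then have i: "i < m j" using Bs[OF j] by simp
  have row_len: "\<And>j. j < d \<Longrightarrow> length (rows (Bs j)) = m j"
    using carrier_matD(1)[OF Bs] by simp
  have less: "offset m j + i < offset m d" using offset_add_less[of j d i m, OF j i] .
  have nth: "concat (map (\<lambda>j. rows (Bs j)) [0..<d]) ! (offset m j + i) = row (Bs j) i"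
    using nth_concat_blocks[of d "\<lambda>j. rows (Bs j)" m j i, OF row_len j i] i Bs[OF j] by simp
  have "row (stack_rows n d Bs) (offset m j + i) = row (Bs j) i"
    unfolding stack_rows_def
  proof (subst mat_of_rows_row)
    show "offset m j + i < length (concat (map (\<lambda>j. rows (Bs j)) [0..<d]))"
      using less length_concat_blocks[of d "\<lambda>j. rows (Bs j)" m, OF row_len] by simp
    show "concat (map (\<lambda>j. rows (Bs j)) [0..<d]) ! (offset m j + i) \<in> carrier_vec n"
      unfolding nth using Bs[OF j] by auto
  qed (rule nth)
  then show "block m j (stack_rows n d Bs *\<^sub>v x) $ i = (Bs j *\<^sub>v x) $ i"
    using i less stack_rows_carrier[of d Bs m n, OF Bs] Bs[OF j] by (simp add: block_def)
qed

lemma block_selector_mult_vec: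
  assumes y: "y \<in> carrier_vec N" and le: "offset m j + m j \<le> N"
  shows "block_selector m N j *\<^sub>v y = block m j y"
proof (rule eq_vecI)
  fix i assume "i < dim_vec (block m j y)"
  then have i: "i < m j" by (simp add: block_def)
  have "(\<Sum>k = 0..<N. (if k = offset m j + i then 1 else 0) * y $ k) = y $ (offset m j + i)"
    using i le by (subst sum.remove[of _ "offset m j + i"]) (auto intro!: sum.neutral)
  then show "(block_selector m N j *\<^sub>v y) $ i = block m j y $ i"
    using i y by (simp add: block_selector_def block_def scalar_prod_def)
qed (simp add: block_def block_selector_def)

text \<open>
  The 1-norm of each block weighted by its own parameter, written with blocks instead of selector
  matrices because the entries of a block are entries of the whole vector.
\<close>

definition weighted_l1 :: "nat \<Rightarrow> (nat \<Rightarrow> nat) \<Rightarrow> (nat \<Rightarrow> real) \<Rightarrow> real vec \<Rightarrow> real" where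
  "weighted_l1 d m lam y = (\<Sum>j<d. lam j * l1_norm (block m j y))"

lemma weighted_l1_entries:
  "weighted_l1 d m lam y = (\<Sum>j<d. lam j * (\<Sum>i<m j. \<bar>y $ (offset m j + i)\<bar>))"
  by (simp add: weighted_l1_def l1_norm_def block_def)

lemma convex_weighted_l1:
  assumes lam: "\<And>j. j < d \<Longrightarrow> 0 \<le> lam j" and N: "offset m d \<le> N"
  shows "convex_fun N (weighted_l1 d m lam)"
  unfolding convex_fun_def
proof (intro ballI allI impI)
  fix x y :: "real vec" and t :: real
  assume x: "x \<in> carrier_vec N" and y: "y \<in> carrier_vec N" and t: "0 \<le> t \<and> t \<le> 1"
  let ?p = "t \<cdot>\<^sub>v x + (1 - t) \<cdot>\<^sub>v y"
  have entry: "\<bar>?p $ (offset m j + i)\<bar> \<le> t * \<bar>x $ (offset m j + i)\<bar> + (1 - t) * \<bar>y $ (offset m j + i)\<bar>"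
    if "j < d" "i < m j" for j i
  proof -
    have "offset m j + i < N" using offset_add_less[of j d i m, OF that] N by simp
    then show ?thesis
      using x y t abs_triangle_ineq[of "t * x $ (offset m j + i)" "(1 - t) * y $ (offset m j + i)"]
      by (simp add: abs_mult)
  qed
  have "weighted_l1 d m lam ?p
      \<le> (\<Sum>j<d. lam j * (\<Sum>i<m j. t * \<bar>x $ (offset m j + i)\<bar> + (1 - t) * \<bar>y $ (offset m j + i)\<bar>))"
    unfolding weighted_l1_entries using lam entry
    by (intro sum_mono mult_left_mono) auto
  also have "\<dots> = t * weighted_l1 d m lam x + (1 - t) * weighted_l1 d m lam y"
    by (simp add: weighted_l1_entries sum.distrib sum_distrib_left distrib_left mult.left_commute)
  finally show "weighted_l1 d m lam ?p \<le> t * weighted_l1 d m lam x + (1 - t) * weighted_l1 d m lam y" .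
qed

lemma weighted_l1_add_unit:
  assumes w: "w \<in> carrier_vec N" and N: "offset m d \<le> N" and j: "j < d" and i: "i < m j"
  shows "weighted_l1 d m lam (w + t \<cdot>\<^sub>v unit_vec N (offset m j + i))
       = weighted_l1 d m lam w
         + lam j * (\<bar>w $ (offset m j + i) + t\<bar> - \<bar>w $ (offset m j + i)\<bar>)"
proof -
  let ?s = "offset m j + i" and ?w = "w + t \<cdot>\<^sub>v unit_vec N (offset m j + i)"
  have entry: "\<bar>?w $ (offset m j' + i')\<bar> = \<bar>w $ (offset m j' + i')\<bar>
      + (if i' = i then if j' = j then \<bar>w $ ?s + t\<bar> - \<bar>w $ ?s\<bar> else 0 else 0)"
    if "j' < d" "i' < m j'" for j' i'
  proof -
    have "offset m j' + i' < N" "?s < N"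
      using offset_add_less[of j' d i' m, OF that] offset_add_less[of j d i m, OF j i] N by simp_all
    then show ?thesis using w offset_add_eq_iff[of i' m j' i j] that i
      by (auto simp: offset_add_eq_iff)
  qed
  have "(\<Sum>i'<m j'. \<bar>?w $ (offset m j' + i')\<bar>) = (\<Sum>i'<m j'. \<bar>w $ (offset m j' + i')\<bar>)
      + (if j' = j then \<bar>w $ ?s + t\<bar> - \<bar>w $ ?s\<bar> else 0)" if "j' < d" for j'
  proof -
    have "(\<Sum>i'<m j'. \<bar>?w $ (offset m j' + i')\<bar>) = (\<Sum>i'<m j'. \<bar>w $ (offset m j' + i')\<bar>
      + (if i' = i then if j' = j then \<bar>w $ ?s + t\<bar> - \<bar>w $ ?s\<bar> else 0 else 0))"
      by (rule sum.cong) (use entry that in auto)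
    then show ?thesis using i by (simp add: sum.distrib)
  qed
  then have "weighted_l1 d m lam ?w = (\<Sum>j'<d. lam j' * (\<Sum>i'<m j'. \<bar>w $ (offset m j' + i')\<bar>)
      + (if j' = j then lam j * (\<bar>w $ ?s + t\<bar> - \<bar>w $ ?s\<bar>) else 0))"
    unfolding weighted_l1_entries by (intro sum.cong) (auto simp: distrib_left)
  then show ?thesis using j by (simp add: sum.distrib weighted_l1_entries)
qed

lemma weighted_l1_add_unit_tail:
  assumes w: "w \<in> carrier_vec N" and s: "offset m d \<le> s" "s < N"
  shows "weighted_l1 d m lam (w + t \<cdot>\<^sub>v unit_vec N s) = weighted_l1 d m lam w"
  unfolding weighted_l1_entries
proof (intro sum.cong arg_cong2[where f = "(*)"] refl)
  fix j i assume "j \<in> {..<d}" "i \<in> {..<m j}"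
  then have "offset m j + i < s" using offset_add_less[of j d i m] s by simp
  then show "\<bar>(w + t \<cdot>\<^sub>v unit_vec N s) $ (offset m j + i)\<bar> = \<bar>w $ (offset m j + i)\<bar>"
    using w s by simp
qed

text \<open>
  The weighted 1-norm is a sum of functions of single entries, so moving along one coordinate axis
  isolates one entry of the subgradient. At a nonzero entry \<open>x\<close>, the steps
  \<open>x\<close> and \<open>-x\<close> bound \<open>x\<close> times the entry of the subgradient
  from both sides by the same number; at a zero entry, the steps \<open>1\<close> and
  \<open>-1\<close> give the bound on the absolute value; and behind the blocks the function does
  not change at all.
\<close>

lemma weighted_l1_subgradient:
  assumes w: "w \<in> carrier_vec N" and N: "offset m d \<le> N"
    and g: "g \<in> subdifferential N (\<lambda>y. ereal (weighted_l1 d m lam y)) w"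
  shows weighted_l1_subgradient_tail: "\<And>s. offset m d \<le> s \<Longrightarrow> s < N \<Longrightarrow> g $ s = 0"
    and weighted_l1_subgradient_nonzero:
      "\<And>j i. j < d \<Longrightarrow> i < m j \<Longrightarrow> w $ (offset m j + i) \<noteq> 0 \<Longrightarrow>
         lam j = g $ (offset m j + i) * sgn (w $ (offset m j + i))"
    and weighted_l1_subgradient_zero:
      "\<And>j i. j < d \<Longrightarrow> i < m j \<Longrightarrow> w $ (offset m j + i) = 0 \<Longrightarrow>
         \<bar>g $ (offset m j + i)\<bar> \<le> lam j"
proof -
  have step: "weighted_l1 d m lam w + t * g $ s \<le> weighted_l1 d m lam (w + t \<cdot>\<^sub>v unit_vec N s)"
    if s: "s < N" for s t
  proof -
    have "w + t \<cdot>\<^sub>v unit_vec N s - w = t \<cdot>\<^sub>v unit_vec N s"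
      by (rule eq_vecI) (use w in auto)
    moreover have "w + t \<cdot>\<^sub>v unit_vec N s \<in> carrier_vec N" using w by simp
    ultimately have "weighted_l1 d m lam w + g \<bullet> (t \<cdot>\<^sub>v unit_vec N s)
        \<le> weighted_l1 d m lam (w + t \<cdot>\<^sub>v unit_vec N s)"
      using g by (force simp: subdifferential_def)
    then show ?thesis using g s by (simp add: subdifferential_def)
  qed
  show "g $ s = 0" if "offset m d \<le> s" "s < N" for s
    using step[OF that(2), of 1] step[OF that(2), of "-1"]
    unfolding weighted_l1_add_unit_tail[OF w that] by simp
  have entry: "t * g $ (offset m j + i)
      \<le> lam j * (\<bar>w $ (offset m j + i) + t\<bar> - \<bar>w $ (offset m j + i)\<bar>)"
    if "j < d" "i < m j" for j i t
    using step[of "offset m j + i" t] weighted_l1_add_unit[OF w N that]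
      offset_add_less[of j d i m, OF that] N by simp
  show "lam j = g $ (offset m j + i) * sgn (w $ (offset m j + i))"
    if "j < d" "i < m j" "w $ (offset m j + i) \<noteq> 0" for j i
  proof -
    let ?x = "w $ (offset m j + i)"
    have "?x * g $ (offset m j + i) = lam j * \<bar>?x\<bar>"
      using entry[OF that(1,2), of ?x] entry[OF that(1,2), of "- ?x"] by (auto simp: abs_mult)
    then have "?x * g $ (offset m j + i) = ?x * (lam j * sgn ?x)"
      by (simp add: abs_sgn mult.left_commute)
    then have "g $ (offset m j + i) = lam j * sgn ?x" using that(3) by simp
    then show ?thesis using that(3) by (simp add: mult.assoc sgn_mult_self_eq)
  qed
  show "\<bar>g $ (offset m j + i)\<bar> \<le> lam j"
    if "j < d" "i < m j" "w $ (offset m j + i) = 0" for j i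
    using entry[OF that(1,2), of 1] entry[OF that(1,2), of "-1"] that(3) by auto
qed

section \<open>Inverting the lifting by the singular value decomposition\<close>

lemma orthogonal_group_mult_vec:
  assumes U: "U \<in> orthogonal_group s" and x: "x \<in> carrier_vec s"
  shows "U *\<^sub>v (U\<^sup>T *\<^sub>v x) = x" and "U\<^sup>T *\<^sub>v (U *\<^sub>v x) = x"
proof -
  have Uc: "U \<in> carrier_mat s s" "U\<^sup>T \<in> carrier_mat s s"
    and UU: "U\<^sup>T * U = 1\<^sub>m s" "U * U\<^sup>T = 1\<^sub>m s"
    using U by (auto simp: orthogonal_group_def)
  show "U *\<^sub>v (U\<^sup>T *\<^sub>v x) = x"
    using assoc_mult_mat_vec[OF Uc x] UU x by simp
  show "U\<^sup>T *\<^sub>v (U *\<^sub>v x) = x"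
    using assoc_mult_mat_vec[OF Uc(2,1) x] UU x by simp
qed

text \<open>
  The defining factorisation of \<open>B\<close> mentions the dimensions of \<open>B\<close>. Here
  they are replaced by \<open>p\<close> and \<open>n\<close>, so that the equation for
  \<open>B\<close> no longer has \<open>B\<close> on its right-hand side.
\<close>

lemma is_svdD:
  assumes svd: "is_svd B r U \<sigma> V" and B: "B \<in> carrier_mat p n"
  shows "U \<in> orthogonal_group p" "U \<in> carrier_mat p p"
    and "V \<in> orthogonal_group n" "V \<in> carrier_mat n n"
    and "i < r \<Longrightarrow> \<sigma> i > 0"
    and "B = U * mat p n (\<lambda>(i, j). if i = j \<and> i < r then \<sigma> i else 0) * V\<^sup>T"
  using svd unfolding is_svd_def carrier_matD[OF B] orthogonal_group_def by blast+

text \<open>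
  In the coordinates given by \<open>V\<^sup>T\<close>, multiplication by \<open>B\<close>
  rescales the first \<open>r\<close> entries and discards the others.
\<close>

lemma svd_mult_vec:
  assumes svd: "is_svd B r U \<sigma> V" and B: "B \<in> carrier_mat p n" and r: "r \<le> p" "r \<le> n"
    and x: "x \<in> carrier_vec n"
  shows "B *\<^sub>v x = U *\<^sub>v vec p (\<lambda>i. if i < r then \<sigma> i * (V\<^sup>T *\<^sub>v x) $ i else 0)"
proof -
  let ?L = "mat p n (\<lambda>(i, j). if i = j \<and> i < r then \<sigma> i else 0)"
  have U: "U \<in> carrier_mat p p" and V: "V \<in> carrier_mat n n" and eq: "B = U * ?L * V\<^sup>T"
    by (fact is_svdD[OF svd B])+
  have Vx: "V\<^sup>T *\<^sub>v x \<in> carrier_vec n" using V x by auto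
  have "?L *\<^sub>v y = vec p (\<lambda>i. if i < r then \<sigma> i * y $ i else 0)" (is "_ = ?R")
    if y: "y \<in> carrier_vec n" for y
  proof (rule eq_vecI)
    fix i assume "i < dim_vec ?R"
    then have i: "i < p" by simp
    have "(?L *\<^sub>v y) $ i = (\<Sum>j = 0..<n. (if i = j \<and> i < r then \<sigma> i else 0) * y $ j)"
      using i y by (simp add: scalar_prod_def)
    also have "\<dots> = (\<Sum>j = 0..<n. if i = j then if i < r then \<sigma> i * y $ i else 0 else 0)"
      by (rule sum.cong) auto
    also have "\<dots> = (if i < r then \<sigma> i * y $ i else 0)" using r by simp
    finally show "(?L *\<^sub>v y) $ i = ?R $ i" using i by simp
  qed simp
  note this[OF Vx]
  moreover have "B *\<^sub>v x = U *\<^sub>v (?L *\<^sub>v (V\<^sup>T *\<^sub>v x))"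
  proof -
    have L: "?L \<in> carrier_mat p n" and VT: "V\<^sup>T \<in> carrier_mat n n" using V by auto
    have "B *\<^sub>v x = (U * ?L) *\<^sub>v (V\<^sup>T *\<^sub>v x)"
      unfolding eq by (rule assoc_mult_mat_vec[OF mult_carrier_mat[OF U L] VT x])
    also have "\<dots> = U *\<^sub>v (?L *\<^sub>v (V\<^sup>T *\<^sub>v x))" by (rule assoc_mult_mat_vec[OF U L Vx])
    finally show ?thesis .
  qed
  ultimately show ?thesis by simp
qed

lemma B_prime_carrier:
  assumes U: "U \<in> carrier_mat p p" and V: "V \<in> carrier_mat n n" and r: "r \<le> p" "r \<le> n"
  shows "B_prime n r U \<sigma> V \<in> carrier_mat n (p + (n - r))"
proof -
  define C where "C = (mat_of_cols (dim_row U) (take r (cols U)))\<^sup>T"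
  have dims: "dim_row C = r" "dim_col C = p" using carrier_matD[OF U] r
    by (simp_all only: C_def index_transpose_mat mat_of_cols_carrier
        length_take cols_length min_absorb2)
  have rows: "dim_row (diag_block_mat [C, 1\<^sub>m (n - r)]) = n"
    unfolding dim_diag_block_mat using dims r by (simp only: list.map sum_list.Cons sum_list.Nil index_one_mat)
  have cols: "dim_col (diag_block_mat [C, 1\<^sub>m (n - r)]) = p + (n - r)"
    unfolding dim_diag_block_mat using dims r by (simp only: list.map sum_list.Cons sum_list.Nil index_one_mat)
  show ?thesis unfolding B_prime_def C_def[symmetric] carrier_mat_def mem_Collect_eq index_mult_mat rows cols
    using V by blast
qed

text \<open>
  In the coordinates given by \<open>V\<^sup>T\<close>, the matrix \<open>B'\<close> undoes the
  rescaling done by \<open>B\<close> and takes the entries that \<open>B\<close> discards from the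
  appended vector.
\<close>

lemma B_prime_mult_append:
  assumes U: "U \<in> carrier_mat p p" and V: "V \<in> carrier_mat n n" and r: "r \<le> p" "r \<le> n"
    and z: "z \<in> carrier_vec p" and v: "v \<in> carrier_vec (n - r)"
  shows "B_prime n r U \<sigma> V *\<^sub>v (z @\<^sub>v v)
       = V *\<^sub>v vec n (\<lambda>i. if i < r then inverse (\<sigma> i) * (U\<^sup>T *\<^sub>v z) $ i else v $ (i - r))"
proof -
  define C where "C = (mat_of_cols (dim_row U) (take r (cols U)))\<^sup>T"
  let ?E = "diag_block_mat [C, 1\<^sub>m (n - r)]"
  let ?d = "\<lambda>i. if i < r then inverse (\<sigma> i) else 1"
  let ?D = "mat_diag n ?d"
  have dims: "dim_row C = r" "dim_col C = p" using carrier_matD[OF U] r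
    by (simp_all only: C_def index_transpose_mat mat_of_cols_carrier
        length_take cols_length min_absorb2)
  have C: "C \<in> carrier_mat r p" using dims by (rule carrier_matI)
  have C_mult: "(C *\<^sub>v z) $ i = (U\<^sup>T *\<^sub>v z) $ i" if "i < r" for i
  proof -
    have "row C i = col U i"
      using that dims carrier_matD[OF U] r
      by (intro eq_vecI) (simp_all add: C_def mat_of_cols_def)
    then show ?thesis using that dims carrier_matD[OF U] r by simp
  qed
  have Cz: "C *\<^sub>v z \<in> carrier_vec r" using C z by simp
  have E_eq: "?E = four_block_mat C (0\<^sub>m r (n - r)) (0\<^sub>m (n - r) p) (1\<^sub>m (n - r))"
    using carrier_matD[OF C]
    by (subst diag_block_mat.simps(2)) (simp only: diag_block_mat_singleton Let_def index_one_mat)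
  have E: "?E \<in> carrier_mat n (p + (n - r))"
    unfolding E_eq using four_block_carrier_mat[OF C one_carrier_mat[of "n - r"]] r(2)
    by (metis le_add_diff_inverse)
  have zv: "z @\<^sub>v v \<in> carrier_vec (p + (n - r))" using z v by simp
  have "?E *\<^sub>v (z @\<^sub>v v)
      = (C *\<^sub>v z + 0\<^sub>m r (n - r) *\<^sub>v v) @\<^sub>v (0\<^sub>m (n - r) p *\<^sub>v z + 1\<^sub>m (n - r) *\<^sub>v v)"
    unfolding E_eq by (rule four_block_mat_mult_vec[OF C _ _ _ z v]) auto
  also have "C *\<^sub>v z + 0\<^sub>m r (n - r) *\<^sub>v v = C *\<^sub>v z"
    by (rule eq_vecI) (use Cz C v in auto)
  also have "0\<^sub>m (n - r) p *\<^sub>v z + 1\<^sub>m (n - r) *\<^sub>v v = v"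
    by (rule eq_vecI) (use z v in auto)
  finally have E_mult: "?E *\<^sub>v (z @\<^sub>v v) = (C *\<^sub>v z) @\<^sub>v v" .
  have D_mult: "?D *\<^sub>v y = vec n (\<lambda>i. ?d i * y $ i)" if y: "y \<in> carrier_vec n" for y
  proof (rule eq_vecI)
    fix i assume "i < dim_vec (vec n (\<lambda>i. ?d i * y $ i))"
    then have i: "i < n" by simp
    have "(?D *\<^sub>v y) $ i = (\<Sum>j = 0..<n. (if i = j then ?d j else 0) * y $ j)"
      using i y by (simp add: mat_diag_def scalar_prod_def)
    also have "\<dots> = (\<Sum>j = 0..<n. if i = j then ?d i * y $ i else 0)"
      by (rule sum.cong) auto
    finally show "(?D *\<^sub>v y) $ i = vec n (\<lambda>i. ?d i * y $ i) $ i" using i by simp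
  qed (simp add: mat_diag_def)
  have y: "(C *\<^sub>v z) @\<^sub>v v \<in> carrier_vec n" using append_carrier_vec[OF Cz v] r by simp
  have entry: "((C *\<^sub>v z) @\<^sub>v v) $ i = (if i < r then (U\<^sup>T *\<^sub>v z) $ i else v $ (i - r))" if "i < n" for i
  proof -
    have "i < dim_vec (C *\<^sub>v z) + dim_vec v" using that carrier_vecD[OF Cz] carrier_vecD[OF v] r by linarith
    then show ?thesis using C_mult[of i] carrier_vecD[OF Cz] by (simp only: index_append_vec(1) split: if_split) simp
  qed
  have "?D *\<^sub>v (?E *\<^sub>v (z @\<^sub>v v))
      = vec n (\<lambda>i. if i < r then inverse (\<sigma> i) * (U\<^sup>T *\<^sub>v z) $ i else v $ (i - r))"
    unfolding E_mult D_mult[OF y] by (rule eq_vecI) (simp_all only: index_vec dim_vec entry, auto)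
  moreover have "B_prime n r U \<sigma> V *\<^sub>v (z @\<^sub>v v) = V *\<^sub>v (?D *\<^sub>v (?E *\<^sub>v (z @\<^sub>v v)))"
  proof -
    have D: "?D \<in> carrier_mat n n" by simp
    have "B_prime n r U \<sigma> V *\<^sub>v (z @\<^sub>v v) = (V * ?D) *\<^sub>v (?E *\<^sub>v (z @\<^sub>v v))"
      unfolding B_prime_def C_def[symmetric]
      by (rule assoc_mult_mat_vec[OF mult_carrier_mat[OF V D] E zv])
    also have "\<dots> = V *\<^sub>v (?D *\<^sub>v (?E *\<^sub>v (z @\<^sub>v v)))"
      by (rule assoc_mult_mat_vec[OF V D mult_mat_vec_carrier[OF E zv]])
    finally show ?thesis .
  qed
  ultimately show ?thesis by simp
qed

lemma mat_range_iff:
  "B \<in> carrier_mat p n \<Longrightarrow> z \<in> mat_range B \<longleftrightarrow> (\<exists>x \<in> carrier_vec n. z = B *\<^sub>v x)"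
  by (auto simp: mat_range_def)

text \<open>
  The right-hand side is the orthogonal projection of \<open>z\<close> onto the range of
  \<open>B\<close>: keep the coefficients along the first \<open>r\<close> left singular vectors.
  The appended vector only contributes in the kernel of \<open>B\<close>.
\<close>

lemma mult_B_prime_append:
  assumes svd: "is_svd B r U \<sigma> V" and B: "B \<in> carrier_mat p n" and r: "r \<le> p" "r \<le> n"
    and z: "z \<in> carrier_vec p" and v: "v \<in> carrier_vec (n - r)"
  shows "B *\<^sub>v (B_prime n r U \<sigma> V *\<^sub>v (z @\<^sub>v v))
       = U *\<^sub>v vec p (\<lambda>i. if i < r then (U\<^sup>T *\<^sub>v z) $ i else 0)"
proof -
  have U: "U \<in> carrier_mat p p" and V: "V \<in> carrier_mat n n" "V \<in> orthogonal_group n"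
    and pos: "\<And>i. i < r \<Longrightarrow> \<sigma> i > 0"
    by (fact is_svdD[OF svd B])+
  let ?y = "vec n (\<lambda>i. if i < r then inverse (\<sigma> i) * (U\<^sup>T *\<^sub>v z) $ i else v $ (i - r))"
  have Vy: "V *\<^sub>v ?y \<in> carrier_vec n" using V(1) by simp
  have "V\<^sup>T *\<^sub>v (V *\<^sub>v ?y) = ?y" by (rule orthogonal_group_mult_vec(2)[OF V(2)]) simp
  then have "B *\<^sub>v (V *\<^sub>v ?y) = U *\<^sub>v vec p (\<lambda>i. if i < r then \<sigma> i * ?y $ i else 0)"
    unfolding svd_mult_vec[OF svd B r Vy] by (rule arg_cong)
  also have "vec p (\<lambda>i. if i < r then \<sigma> i * ?y $ i else 0)
      = vec p (\<lambda>i. if i < r then (U\<^sup>T *\<^sub>v z) $ i else 0)"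
    by (rule eq_vecI) (use r pos in \<open>auto simp: less_imp_neq[symmetric]\<close>)
  finally show ?thesis unfolding B_prime_mult_append[OF U V(1) r z v] .
qed

text \<open>
  What the projection removes has only coefficients along the last left singular vectors, while
  the range of \<open>B\<close> has only coefficients along the first \<open>r\<close>.
\<close>

lemma svd_projection:
  assumes svd: "is_svd B r U \<sigma> V" and B: "B \<in> carrier_mat p n" and r: "r \<le> p" "r \<le> n"
    and z: "z \<in> carrier_vec p" and x: "x \<in> carrier_vec n"
  shows "(z - U *\<^sub>v vec p (\<lambda>i. if i < r then (U\<^sup>T *\<^sub>v z) $ i else 0)) \<bullet> (B *\<^sub>v x) = 0"
proof -
  have U: "U \<in> carrier_mat p p" "U \<in> orthogonal_group p"
    by (fact is_svdD[OF svd B])+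
  let ?h = "vec p (\<lambda>i. if i < r then (U\<^sup>T *\<^sub>v z) $ i else 0)"
  let ?y = "vec p (\<lambda>i. if i < r then \<sigma> i * (V\<^sup>T *\<^sub>v x) $ i else 0)"
  have Uz: "U\<^sup>T *\<^sub>v z \<in> carrier_vec p" using U z by simp
  have "(z - U *\<^sub>v ?h) \<bullet> (U *\<^sub>v ?y) = (U\<^sup>T *\<^sub>v (z - U *\<^sub>v ?h)) \<bullet> ?y"
    by (rule transpose_vec_mult_scalar[symmetric, of _ p p]) (use U z in auto)
  also have "U\<^sup>T *\<^sub>v (z - U *\<^sub>v ?h) = U\<^sup>T *\<^sub>v z - U\<^sup>T *\<^sub>v (U *\<^sub>v ?h)"
    by (rule mult_minus_distrib_mat_vec[of _ p p]) (use U z in auto)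
  also have "U\<^sup>T *\<^sub>v (U *\<^sub>v ?h) = ?h" by (rule orthogonal_group_mult_vec(2)[OF U(2)]) simp
  also have "(U\<^sup>T *\<^sub>v z - ?h) \<bullet> ?y = 0"
    unfolding scalar_prod_def by (rule sum.neutral) auto
  finally show ?thesis using svd_mult_vec[OF svd B r x] by simp
qed

lemma mult_B_prime_range:
  assumes svd: "is_svd B r U \<sigma> V" and B: "B \<in> carrier_mat p n" and r: "r \<le> p" "r \<le> n"
    and z: "z \<in> mat_range B" and v: "v \<in> carrier_vec (n - r)"
  shows "B *\<^sub>v (B_prime n r U \<sigma> V *\<^sub>v (z @\<^sub>v v)) = z"
proof -
  have U: "U \<in> carrier_mat p p" "U \<in> orthogonal_group p"
    by (fact is_svdD[OF svd B])+
  obtain x where x: "x \<in> carrier_vec n" "z = B *\<^sub>v x" using z mat_range_iff[OF B] by auto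
  have zc: "z \<in> carrier_vec p" using x B by simp
  let ?y = "vec p (\<lambda>i. if i < r then \<sigma> i * (V\<^sup>T *\<^sub>v x) $ i else 0)"
  have zy: "z = U *\<^sub>v ?y" using svd_mult_vec[OF svd B r x(1)] x(2) by simp
  have "U\<^sup>T *\<^sub>v z = ?y" unfolding zy by (rule orthogonal_group_mult_vec(2)[OF U(2)]) simp
  then have "vec p (\<lambda>i. if i < r then (U\<^sup>T *\<^sub>v z) $ i else 0) = ?y"
    by (intro eq_vecI) auto
  then show ?thesis unfolding mult_B_prime_append[OF svd B r zc v] zy[symmetric] by (simp add: zy[symmetric])
qed

text \<open>
  The appended vector consists of the coefficients of \<open>x\<close> along the right singular
  vectors that span the kernel of \<open>B\<close>, which are lost in \<open>B x\<close>. So the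
  original problem can be carried over to pairs with first component in the range of
  \<open>B\<close> without losing any competitor.
\<close>

lemma B_prime_surj_lift:
  assumes svd: "is_svd B r U \<sigma> V" and B: "B \<in> carrier_mat p n" and r: "r \<le> p" "r \<le> n"
    and x: "x \<in> carrier_vec n"
  obtains v where "v \<in> carrier_vec (n - r)" "B_prime n r U \<sigma> V *\<^sub>v ((B *\<^sub>v x) @\<^sub>v v) = x"
proof
  have U: "U \<in> carrier_mat p p" "U \<in> orthogonal_group p"
    and V: "V \<in> carrier_mat n n" "V \<in> orthogonal_group n"
    and pos: "\<And>i. i < r \<Longrightarrow> \<sigma> i > 0"
    by (fact is_svdD[OF svd B])+
  let ?v = "vec (n - r) (\<lambda>i. (V\<^sup>T *\<^sub>v x) $ (i + r))"
  show v: "?v \<in> carrier_vec (n - r)" by simp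
  have Bx: "B *\<^sub>v x \<in> carrier_vec p" using B x by simp
  have Vx: "V\<^sup>T *\<^sub>v x \<in> carrier_vec n" using V x by simp
  let ?y = "vec p (\<lambda>i. if i < r then \<sigma> i * (V\<^sup>T *\<^sub>v x) $ i else 0)"
  have Uy: "U\<^sup>T *\<^sub>v (B *\<^sub>v x) = ?y"
    by (subst svd_mult_vec[OF svd B r x]) (rule orthogonal_group_mult_vec(2)[OF U(2)], simp)
  have "vec n (\<lambda>i. if i < r then inverse (\<sigma> i) * ?y $ i else ?v $ (i - r)) = V\<^sup>T *\<^sub>v x"
  proof (rule eq_vecI)
    fix i assume "i < dim_vec (V\<^sup>T *\<^sub>v x)"
    then have "i < n" unfolding carrier_vecD[OF Vx] .
    then show "vec n (\<lambda>i. if i < r then inverse (\<sigma> i) * ?y $ i else ?v $ (i - r)) $ i = (V\<^sup>T *\<^sub>v x) $ i"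
      using r pos[of i] by (auto simp del: index_mult_mat_vec)
  qed (use V in auto)
  then show "B_prime n r U \<sigma> V *\<^sub>v ((B *\<^sub>v x) @\<^sub>v ?v) = x"
    unfolding B_prime_mult_append[OF U(1) V(1) r Bx v] Uy
    using orthogonal_group_mult_vec(1)[OF V(2) x] by simp
qed

section \<open>The subspace of lifted vectors and its support function\<close>

lemma lifted_rangeI:
  assumes B: "B \<in> carrier_mat p n" and x: "x \<in> carrier_vec n" and v: "v \<in> carrier_vec k"
  shows "(B *\<^sub>v x) @\<^sub>v v \<in> lifted_range B k"
proof -
  have "B *\<^sub>v x \<in> mat_range B" unfolding mat_range_iff[OF B] using x by (intro bexI) simp
  with v have "\<exists>q v'. (B *\<^sub>v x) @\<^sub>v v = q @\<^sub>v v' \<and> q \<in> mat_range B \<and> v' \<in> carrier_vec k"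
    by (intro exI[of _ "B *\<^sub>v x"] exI[of _ v] conjI refl)
  then show ?thesis unfolding lifted_range_def by (rule CollectI)
qed

lemma lifted_rangeE:
  assumes y: "y \<in> lifted_range B k" and B: "B \<in> carrier_mat p n"
  obtains x v where "x \<in> carrier_vec n" "v \<in> carrier_vec k" "y = (B *\<^sub>v x) @\<^sub>v v"
proof -
  obtain q v where "y = q @\<^sub>v v" "q \<in> mat_range B" "v \<in> carrier_vec k"
    using y unfolding lifted_range_def by (elim CollectE exE conjE)
  moreover from this obtain x where "x \<in> carrier_vec n" "q = B *\<^sub>v x"
    unfolding mat_range_iff[OF B] by (elim bexE)
  ultimately show thesis using that by simp
qed

lemma lifted_range_carrier:
  assumes B: "B \<in> carrier_mat p n" shows "lifted_range B k \<subseteq> carrier_vec (p + k)"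
proof
  fix y assume "y \<in> lifted_range B k"
  then obtain x v where "x \<in> carrier_vec n" "v \<in> carrier_vec k" "y = (B *\<^sub>v x) @\<^sub>v v"
    using B by (rule lifted_rangeE)
  then show "y \<in> carrier_vec (p + k)" using mult_mat_vec_carrier[OF B] by simp
qed

lemma lifted_range_smult:
  assumes B: "B \<in> carrier_mat p n" and y: "y \<in> lifted_range B k"
  shows "t \<cdot>\<^sub>v y \<in> lifted_range B k"
proof -
  obtain x v where x: "x \<in> carrier_vec n" and v: "v \<in> carrier_vec k" and yeq: "y = (B *\<^sub>v x) @\<^sub>v v"
    using lifted_rangeE[OF y B] .
  have Bx: "B *\<^sub>v x \<in> carrier_vec p" using mult_mat_vec_carrier[OF B x] .
  have "t \<cdot>\<^sub>v y = (t \<cdot>\<^sub>v (B *\<^sub>v x)) @\<^sub>v (t \<cdot>\<^sub>v v)"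
    unfolding yeq by (rule eq_vecI) (auto simp del: index_mult_mat_vec)
  also have "t \<cdot>\<^sub>v (B *\<^sub>v x) = B *\<^sub>v (t \<cdot>\<^sub>v x)" using mult_mat_vec[OF B x] by simp
  finally show ?thesis using lifted_rangeI[OF B, of "t \<cdot>\<^sub>v x" "t \<cdot>\<^sub>v v" k] x v by simp
qed

text \<open>
  The vector \<open>B\<^sup>T b\<close> is orthogonal to itself, because \<open>B\<close> sends it
  into the range of \<open>B\<close>.
\<close>

lemma mat_kernel_transposeI:
  fixes B :: "real mat"
  assumes B: "B \<in> carrier_mat p n" and b: "b \<in> carrier_vec p"
    and orth: "\<And>x. x \<in> carrier_vec n \<Longrightarrow> (B *\<^sub>v x) \<bullet> b = 0"
  shows "b \<in> mat_kernel (B\<^sup>T)"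
proof (rule mat_kernelI[of _ n p])
  have Bb: "B\<^sup>T *\<^sub>v b \<in> carrier_vec n" using B b by simp
  have "(B\<^sup>T *\<^sub>v b) \<bullet> (B\<^sup>T *\<^sub>v b) = b \<bullet> (B *\<^sub>v (B\<^sup>T *\<^sub>v b))"
    by (rule transpose_vec_mult_scalar[OF B Bb b])
  also have "\<dots> = 0" using orth[OF Bb] comm_scalar_prod[OF b mult_mat_vec_carrier[OF B Bb]] by simp
  finally show "B\<^sup>T *\<^sub>v b = 0\<^sub>v n" using scalar_prod_self_eq_0[OF Bb] by simp
qed (use B b in auto)

text \<open>
  The second factor of the subspace is the full space, so a vector orthogonal to the subspace has
  a vanishing tail, and orthogonality reduces to the first component.
\<close>

lemma orthogonal_lifted_range:
  fixes B :: "real mat"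
  assumes B: "B \<in> carrier_mat p n" and c: "c \<in> carrier_vec (p + k)"
    and orth: "\<And>y. y \<in> lifted_range B k \<Longrightarrow> y \<bullet> c = 0"
  shows "vec_first c p \<in> mat_kernel (B\<^sup>T)"
    and "\<And>i. p \<le> i \<Longrightarrow> i < p + k \<Longrightarrow> c $ i = 0"
proof -
  have split: "c = vec_first c p @\<^sub>v vec_last c k" using c by simp
  have prod: "(B *\<^sub>v x) \<bullet> vec_first c p + v \<bullet> vec_last c k = 0"
    if x: "x \<in> carrier_vec n" and v: "v \<in> carrier_vec k" for x v
  proof -
    have "(B *\<^sub>v x) \<bullet> vec_first c p + v \<bullet> vec_last c k = ((B *\<^sub>v x) @\<^sub>v v) \<bullet> (vec_first c p @\<^sub>v vec_last c k)"
      by (rule scalar_prod_append[symmetric]) (use mult_mat_vec_carrier[OF B x] v in auto)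
    then show ?thesis using orth[OF lifted_rangeI[OF B x v]] split by simp
  qed
  show "vec_first c p \<in> mat_kernel (B\<^sup>T)"
    by (rule mat_kernel_transposeI[OF B]) (use prod[of _ "0\<^sub>v k"] in auto)
  show "c $ i = 0" if i: "p \<le> i" "i < p + k" for i
  proof -
    have "B *\<^sub>v 0\<^sub>v n = 0\<^sub>v p" using B by (intro eq_vecI) auto
    then have "vec_last c k $ (i - p) = 0"
      using prod[of "0\<^sub>v n" "unit_vec k (i - p)"] i by simp
    moreover have "c $ i = vec_last c k $ (i - p)"
      by (subst split, subst index_append_vec(1)) (use i in auto)
    ultimately show ?thesis by simp
  qed
qed

text \<open>
  The support function of a subspace vanishes on the orthogonal complement, so its subgradients at
  a point \<open>c\<close> of that complement lie in the double complement, that is in the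
  subspace. Concretely, let \<open>q\<close> be what remains of \<open>z\<close> after projection
  onto the range of \<open>B\<close>. Then \<open>q\<close> followed by zeros lies in the
  complement, and the subgradient inequality in this direction gives \<open>q \<bullet> q \<le>
  0\<close>.
\<close>

lemma support_function_subgradient_in_range:
  assumes svd: "is_svd B r U \<sigma> V" and B: "B \<in> carrier_mat p n" and r: "r \<le> p" "r \<le> n"
    and z: "z \<in> carrier_vec p" and v: "v \<in> carrier_vec k"
    and c: "c \<in> carrier_vec (p + k)"
    and orth: "\<And>y. y \<in> lifted_range B k \<Longrightarrow> y \<bullet> c = 0"
    and sub: "z @\<^sub>v v \<in> subdifferential (p + k) (fenchel_conj (p + k) (indicator_fun (lifted_range B k))) c"
  shows "z \<in> mat_range B"
proof -
  let ?S = "fenchel_conj (p + k) (indicator_fun (lifted_range B k))"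
  have M: "lifted_range B k \<subseteq> carrier_vec (p + k)" "lifted_range B k \<noteq> {}"
    using lifted_range_carrier[OF B] lifted_rangeI[OF B, of "0\<^sub>v n" "0\<^sub>v k" k] by auto
  define x where "x = B_prime n r U \<sigma> V *\<^sub>v (z @\<^sub>v 0\<^sub>v (n - r))"
  have x: "x \<in> carrier_vec n"
    unfolding x_def
    by (rule mult_mat_vec_carrier[OF B_prime_carrier[OF is_svdD(2)[OF svd B] is_svdD(4)[OF svd B] r]])
      (use z in auto)
  have Bx: "B *\<^sub>v x \<in> carrier_vec p" using mult_mat_vec_carrier[OF B x] .
  define q where "q = z - B *\<^sub>v x"
  have q: "q \<in> carrier_vec p" using z Bx by (simp add: q_def)
  have q_orth: "q \<bullet> (B *\<^sub>v y) = 0" if "y \<in> carrier_vec n" for y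
    unfolding q_def x_def mult_B_prime_append[OF svd B r z zero_carrier_vec]
    by (rule svd_projection[OF svd B r z that])
  have q0: "q @\<^sub>v 0\<^sub>v k \<in> carrier_vec (p + k)" using q by simp
  have "y \<bullet> (c + (q @\<^sub>v 0\<^sub>v k)) = 0" if y: "y \<in> lifted_range B k" for y
  proof -
    obtain x' v' where x': "x' \<in> carrier_vec n" and v': "v' \<in> carrier_vec k"
      and yeq: "y = (B *\<^sub>v x') @\<^sub>v v'" using lifted_rangeE[OF y B] .
    have Bx': "B *\<^sub>v x' \<in> carrier_vec p" using mult_mat_vec_carrier[OF B x'] .
    have "y \<bullet> (q @\<^sub>v 0\<^sub>v k) = (B *\<^sub>v x') \<bullet> q + v' \<bullet> 0\<^sub>v k"
      unfolding yeq by (rule scalar_prod_append[OF Bx' v' q]) simp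
    also have "\<dots> = 0" using q_orth[OF x'] comm_scalar_prod[OF q Bx'] v' by simp
    finally show ?thesis
      using scalar_prod_add_distrib[of y "p + k" c "q @\<^sub>v 0\<^sub>v k"] orth[OF y] y M(1) c q0 by auto
  qed
  then have S0: "?S (c + (q @\<^sub>v 0\<^sub>v k)) = 0" "?S c = 0"
    using fenchel_conj_indicator_orthogonal[OF M] orth by blast+
  have cq: "c + (q @\<^sub>v 0\<^sub>v k) \<in> carrier_vec (p + k)" using c q0 by simp
  have "c + (q @\<^sub>v 0\<^sub>v k) - c = q @\<^sub>v 0\<^sub>v k" by (rule eq_vecI) (use c q in auto)
  then have "0 + ereal ((z @\<^sub>v v) \<bullet> (q @\<^sub>v 0\<^sub>v k)) \<le> 0"
    using sub cq unfolding subdifferential_def by (force simp: S0)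
  then have "(z @\<^sub>v v) \<bullet> (q @\<^sub>v 0\<^sub>v k) \<le> 0" by simp
  moreover have "(z @\<^sub>v v) \<bullet> (q @\<^sub>v 0\<^sub>v k) = z \<bullet> q + v \<bullet> 0\<^sub>v k"
    by (rule scalar_prod_append[OF z v q]) simp
  moreover have "q \<bullet> q = z \<bullet> q"
  proof -
    have "q \<bullet> q = q \<bullet> (z - B *\<^sub>v x)" by (simp add: q_def)
    also have "\<dots> = q \<bullet> z - q \<bullet> (B *\<^sub>v x)" by (rule scalar_prod_minus_distrib[OF q z Bx])
    also have "\<dots> = z \<bullet> q" using q_orth[OF x] comm_scalar_prod[OF q z] by simp
    finally show ?thesis .
  qed
  ultimately have "q \<bullet> q \<le> 0" using v by simp
  then have "q = 0\<^sub>v p" using scalar_prod_self_eq_0[OF q] scalar_prod_self_nonneg[of q] by simp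
  have "z = B *\<^sub>v x"
  proof (rule eq_vecI)
    fix i assume "i < dim_vec (B *\<^sub>v x)"
    then have i: "i < p" unfolding carrier_vecD[OF Bx] .
    have "q $ i = 0" using \<open>q = 0\<^sub>v p\<close> i by simp
    then show "z $ i = (B *\<^sub>v x) $ i" using i carrier_vecD[OF Bx] by (simp add: q_def del: index_mult_mat_vec dim_mult_mat_vec)
  qed (simp only: carrier_vecD[OF z] carrier_vecD[OF Bx])
  then show ?thesis using mat_range_iff[OF B] x by blast
qed

section \<open>From the fixed-point equations to optimality\<close>

theorem theorem5:
  fixes n d r p N :: nat
    and m l :: "nat \<Rightarrow> nat"
    and k :: "nat \<Rightarrow> nat \<Rightarrow> nat"
    and \<psi> :: "real vec \<Rightarrow> real"
    and Bs :: "nat \<Rightarrow> real mat"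
    and B B' U V Om Pm Qm :: "real mat"
    and \<sigma> lam zs :: "nat \<Rightarrow> real"
    and w z v a c b u :: "real vec"
  assumes "n > 0" and "d > 0" and "\<And>j. j < d \<Longrightarrow> m j > 0"
    and "p = offset m d"
    and "\<And>x. x \<in> carrier_vec n \<Longrightarrow> \<psi> x \<ge> 0"
    and "convex_fun n \<psi>"
    and "\<And>j. j < d \<Longrightarrow> Bs j \<in> carrier_mat (m j) n"
    and "B = stack_rows n d Bs"
    and "r = mat_rank B" and "0 < r" and "r \<le> min p n"
    and "is_svd B r U \<sigma> V"
    and "B' = B_prime n r U \<sigma> V"
    and "N = p + n - r"
    and "\<And>j. j < d \<Longrightarrow> lam j > 0"
    and "z \<in> carrier_vec p" and "v \<in> carrier_vec (n - r)" and "w = z @\<^sub>v v"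
    and "\<And>j. j < d \<Longrightarrow> l j < m j + 1"
    and "\<And>j. j < d \<Longrightarrow> strict_mono_on {..<l j} (k j)"
    and "\<And>j i. j < d \<Longrightarrow> i < l j \<Longrightarrow> k j i < m j \<and> zs (offset m j + k j i) \<noteq> 0"
    and "\<And>j. j < d \<Longrightarrow> block m j z =
           finsum_vec TYPE(real) (m j)
             (\<lambda>i. zs (offset m j + k j i) \<cdot>\<^sub>v unit_vec (m j) (k j i)) {..<l j}"
    and "\<And>j. j < d \<Longrightarrow> block m j z \<in> sparse_vecs (m j) (l j)"
    and "a \<in> carrier_vec n" and "c \<in> carrier_vec N"
    and "Om \<in> pos_def_mats N" and "Pm \<in> pos_def_mats n" and "Qm \<in> pos_def_mats N"
    and "w \<in> prox N (\<lambda>y. ereal (\<Sum>j<d. lam j * l1_norm (block_selector m N j *\<^sub>v y))) Om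
               (w - inv_mat Om *\<^sub>v (B'\<^sup>T *\<^sub>v a) - inv_mat Om *\<^sub>v c)"
    and "a \<in> prox n (fenchel_conj n (\<lambda>x. ereal (\<psi> x))) Pm
               (inv_mat Pm *\<^sub>v (B' *\<^sub>v w) + a)"
    and "c \<in> prox N (fenchel_conj N (indicator_fun (lifted_range B (n - r)))) Qm
               (inv_mat Qm *\<^sub>v w + c)"
    and "u = B' *\<^sub>v w"
    and "b = vec_first c p"
  shows "is_arg_min (\<lambda>x. \<psi> x + (\<Sum>j<d. lam j * l1_norm (Bs j *\<^sub>v x)))
           (\<lambda>x. x \<in> carrier_vec n) u
    \<and> (\<forall>j<d. Bs j *\<^sub>v u \<in> sparse_vecs (m j) (l j))
    \<and> a \<in> subdifferential n (\<lambda>x. ereal (\<psi> x)) u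
    \<and> b \<in> mat_kernel (B\<^sup>T)
    \<and> (\<forall>i \<in> {..<N} - {..<p}. col B' i \<bullet> a = 0)
    \<and> (\<forall>j<d.
         (\<forall>i<l j. lam j = - (col B' (offset m j + k j i) \<bullet> a + b $ (offset m j + k j i))
                            * sgn (zs (offset m j + k j i))) \<and>
         (\<forall>i \<in> {..<m j} - k j ` {..<l j}.
            lam j \<ge> \<bar>col B' (offset m j + i) \<bullet> a + b $ (offset m j + i)\<bar>))"
proof -
  have r: "r \<le> p" "r \<le> n" using \<open>r \<le> min p n\<close> by simp_all
  have N: "N = p + (n - r)" using \<open>N = p + n - r\<close> r by simp
  have pN: "offset m d \<le> N" using N \<open>p = offset m d\<close> by simp
  have block_pos: "offset m j + i < p" if "j < d" "i < m j" for j i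
    using offset_add_less[of j d i m, OF that] \<open>p = offset m d\<close> by simp
  have B: "B \<in> carrier_mat p n"
    unfolding \<open>B = stack_rows n d Bs\<close> \<open>p = offset m d\<close> by (rule stack_rows_carrier) (fact assms)
  note svd = \<open>is_svd B r U \<sigma> V\<close>
  have B': "B' \<in> carrier_mat n N"
    unfolding \<open>B' = B_prime n r U \<sigma> V\<close> N
    by (rule B_prime_carrier[OF is_svdD(2)[OF svd B] is_svdD(4)[OF svd B] r])
  note z = \<open>z \<in> carrier_vec p\<close> and v = \<open>v \<in> carrier_vec (n - r)\<close>
    and a = \<open>a \<in> carrier_vec n\<close> and c = \<open>c \<in> carrier_vec N\<close>
  have w: "w \<in> carrier_vec N" unfolding \<open>w = z @\<^sub>v v\<close> N using z v by (rule append_carrier_vec)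
  have u: "u \<in> carrier_vec n" unfolding \<open>u = B' *\<^sub>v w\<close> using B' w by (rule mult_mat_vec_carrier)
  have BT_a: "B'\<^sup>T *\<^sub>v a \<in> carrier_vec N" using B' a by simp
  have w_block: "w $ (offset m j + i) = z $ (offset m j + i)" if "j < d" "i < m j" for j i
    using block_pos[OF that] z v \<open>w = z @\<^sub>v v\<close> by simp
  let ?M = "lifted_range B (n - r)"
  let ?F = "weighted_l1 d m lam"

  (* As psi is nonnegative, its conjugate is at most 0 at the origin. This rules out that the
     conjugate is infinite everywhere, in which case any a would solve its equation. *)
  have "fenchel_conj n (\<lambda>x. ereal (\<psi> x)) (0\<^sub>v n) \<le> 0"
    unfolding fenchel_conj_def
    by (rule SUP_least) (use \<open>\<And>x. x \<in> carrier_vec n \<Longrightarrow> \<psi> x \<ge> 0\<close> in auto)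
  then have conj_0: "fenchel_conj n (\<lambda>x. ereal (\<psi> x)) (0\<^sub>v n) \<noteq> \<infinity>" by auto
  have Pm: "a \<in> prox n (fenchel_conj n (\<lambda>x. ereal (\<psi> x))) Pm (inv_mat Pm *\<^sub>v u + a)"
    unfolding \<open>u = B' *\<^sub>v w\<close> by fact
  note conj_sub = prox_conj_subdifferential[OF \<open>Pm \<in> pos_def_mats n\<close> u Pm zero_carrier_vec refl
      zero_carrier_vec conj_0]
  from conj_sub(2) obtain \<alpha> where "fenchel_conj n (\<lambda>x. ereal (\<psi> x)) a = ereal \<alpha>" ..
  then have a_sub: "a \<in> subdifferential n (\<lambda>x. ereal (\<psi> x)) u"
    using conj_sub(1) by (rule subdifferential_conj_inversion[OF \<open>convex_fun n \<psi>\<close> a])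

  have M: "?M \<subseteq> carrier_vec N" unfolding N by (rule lifted_range_carrier[OF B])
  have M0: "(B *\<^sub>v 0\<^sub>v n) @\<^sub>v 0\<^sub>v (n - r) \<in> ?M" by (rule lifted_rangeI[OF B]) simp_all
  have supp_0: "fenchel_conj N (indicator_fun ?M) (0\<^sub>v N) \<noteq> \<infinity>"
    using fenchel_conj_indicator_orthogonal[OF M, of "0\<^sub>v N"] M0 M by fastforce
  have ind_0: "indicator_fun ?M ((B *\<^sub>v 0\<^sub>v n) @\<^sub>v 0\<^sub>v (n - r)) = ereal 0"
    using M0 by (simp add: indicator_fun_def zero_ereal_def)
  note supp_sub = prox_conj_subdifferential[OF \<open>Qm \<in> pos_def_mats N\<close> w
      \<open>c \<in> prox N (fenchel_conj N (indicator_fun ?M)) Qm (inv_mat Qm *\<^sub>v w + c)\<close>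
      subsetD[OF M M0] ind_0 zero_carrier_vec supp_0]
  (* The support function takes only the values 0 and infinity, so finiteness at c already is
     orthogonality. *)
  from supp_sub(2) obtain \<gamma> where "fenchel_conj N (indicator_fun ?M) c = ereal \<gamma>" ..
  then have c_orth: "y \<bullet> c = 0" if "y \<in> ?M" for y
    using fenchel_conj_indicator_finite[OF M lifted_range_smult[OF B] c _ that] by blast
  have z_range: "z \<in> mat_range B"
    by (rule support_function_subgradient_in_range[OF svd B r z v c[unfolded N] c_orth])
      (use supp_sub(1) N \<open>w = z @\<^sub>v v\<close> in simp_all)
  have w_M: "w \<in> ?M" unfolding \<open>w = z @\<^sub>v v\<close> lifted_range_def using z_range v by blast
  have b_ker: "b \<in> mat_kernel (B\<^sup>T)"
    unfolding \<open>b = vec_first c p\<close> by (rule orthogonal_lifted_range(1)[OF B c[unfolded N] c_orth])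
  have c_tail: "c $ i = 0" if "p \<le> i" "i < N" for i
    by (rule orthogonal_lifted_range(2)[OF B c[unfolded N] c_orth that(1) that(2)[unfolded N]])

  let ?x = "w - inv_mat Om *\<^sub>v (B'\<^sup>T *\<^sub>v a) - inv_mat Om *\<^sub>v c"
  define g where "g = - (B'\<^sup>T *\<^sub>v a + c)"
  have sel: "block_selector m N j *\<^sub>v y = block m j y" if "j < d" "y \<in> carrier_vec N" for j y
    using that offset_mono[of "Suc j" d m] pN by (intro block_selector_mult_vec) (auto simp: offset_Suc)
  have w_prox: "w \<in> prox N (\<lambda>y. ereal (?F y)) Om ?x"
    by (rule prox_cong[OF _ \<open>w \<in> prox N _ Om ?x\<close>]) (simp add: weighted_l1_def sel)
  note Om = \<open>Om \<in> pos_def_mats N\<close>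
  have OmC: "Om \<in> carrier_mat N N" using Om by (simp add: pos_def_mats_def)
  have s: "inv_mat Om *\<^sub>v (B'\<^sup>T *\<^sub>v a) \<in> carrier_vec N" "inv_mat Om *\<^sub>v c \<in> carrier_vec N"
    by (rule pos_def_mult_inverse_vec(1)[OF Om] BT_a c)+
  have F_cvx: "convex_ereal_fun N (\<lambda>y. ereal (?F y))"
    using \<open>\<And>j. j < d \<Longrightarrow> lam j > 0\<close> less_imp_le
    by (intro convex_ereal_fun_ereal convex_weighted_l1[OF _ pN]) blast
  have "Om *\<^sub>v (?x - w) \<in> subdifferential N (\<lambda>y. ereal (?F y)) w"
    by (rule prox_residual_in_subdifferential[OF Om F_cvx _ _ w_prox refl]) (use w s in simp_all)
  moreover have "Om *\<^sub>v (?x - w) = g"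
  proof -
    have "p' - q - q' - p' = - (q + q')"
      if "p' \<in> carrier_vec N" "q \<in> carrier_vec N" "q' \<in> carrier_vec N" for p' q q' :: "real vec"
      by (rule eq_vecI) (use that in auto)
    note cancel = this[OF w s]
    have neg: "Om *\<^sub>v (- q) = - (Om *\<^sub>v q)" if "q \<in> carrier_vec N" for q
      by (rule eq_vecI) (use that OmC in auto)
    from cancel have "Om *\<^sub>v (?x - w)
        = - (Om *\<^sub>v (inv_mat Om *\<^sub>v (B'\<^sup>T *\<^sub>v a) + inv_mat Om *\<^sub>v c))"
      using neg[OF add_carrier_vec[OF s]] by (simp only:)
    also have "\<dots> = g"
      unfolding g_def mult_add_distrib_mat_vec[OF OmC s] pos_def_mult_inverse_vec(2)[OF Om BT_a]
        pos_def_mult_inverse_vec(2)[OF Om c] ..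
    finally show ?thesis .
  qed
  ultimately have g_sub: "g \<in> subdifferential N (\<lambda>y. ereal (?F y)) w" by simp
  have g_entry: "g $ i = - (col B' i \<bullet> a + c $ i)" if "i < N" for i
    using that B' c by (simp add: g_def)
  note l1_sub = weighted_l1_subgradient[OF w pN g_sub]

  have Bu: "B *\<^sub>v u = z"
    unfolding \<open>u = B' *\<^sub>v w\<close> \<open>w = z @\<^sub>v v\<close> \<open>B' = B_prime n r U \<sigma> V\<close>
    by (rule mult_B_prime_range[OF svd B r z_range v])
  have Bs_block: "Bs j *\<^sub>v x = block m j (B *\<^sub>v x)" if "j < d" for j x
    unfolding \<open>B = stack_rows n d Bs\<close>
    by (rule block_stack_rows[symmetric, of d Bs m n, OF _ that]) (fact assms)
  have F_lift: "?F ((B *\<^sub>v x) @\<^sub>v y) = (\<Sum>j<d. lam j * l1_norm (Bs j *\<^sub>v x))"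
    if x: "x \<in> carrier_vec n" and y: "y \<in> carrier_vec (n - r)" for x y
  proof -
    have "block m j ((B *\<^sub>v x) @\<^sub>v y) = block m j (B *\<^sub>v x)" if "j < d" for j
    proof (rule eq_vecI)
      fix i assume "i < dim_vec (block m j (B *\<^sub>v x))"
      then have i: "i < m j" by (simp add: block_def)
      have Bx: "dim_vec (B *\<^sub>v x) = p" using carrier_vecD[OF mult_mat_vec_carrier[OF B x]] .
      have "((B *\<^sub>v x) @\<^sub>v y) $ (offset m j + i) = (B *\<^sub>v x) $ (offset m j + i)"
        using block_pos[OF that i] Bx by (subst index_append_vec(1)) simp_all
      then show "block m j ((B *\<^sub>v x) @\<^sub>v y) $ i = block m j (B *\<^sub>v x) $ i"
        using i by (simp add: block_def del: index_mult_mat_vec)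
    qed (simp add: block_def)
    then show ?thesis by (simp add: weighted_l1_def Bs_block)
  qed
  have optimal: "\<psi> u + (\<Sum>j<d. lam j * l1_norm (Bs j *\<^sub>v u))
      \<le> \<psi> x + (\<Sum>j<d. lam j * l1_norm (Bs j *\<^sub>v x))" if x: "x \<in> carrier_vec n" for x
  proof -
    obtain v' where v': "v' \<in> carrier_vec (n - r)" and lift: "B' *\<^sub>v ((B *\<^sub>v x) @\<^sub>v v') = x"
      unfolding \<open>B' = B_prime n r U \<sigma> V\<close> using B_prime_surj_lift[OF svd B r x] .
    define y where "y = (B *\<^sub>v x) @\<^sub>v v'"
    have yM: "y \<in> ?M" unfolding y_def by (rule lifted_rangeI[OF B x v'])
    then have y: "y \<in> carrier_vec N" using M by blast
    have yw: "y - w \<in> carrier_vec N" using y w by simp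
    have "?F w + g \<bullet> (y - w) \<le> ?F y" using g_sub y by (auto simp: subdifferential_def)
    (* Both y and w lie in M, so c drops out and the linear term is the one of the subgradient
       inequality of psi, with the opposite sign. *)
    moreover have "g \<bullet> (y - w) = - (a \<bullet> (x - u))"
    proof -
      have "g \<bullet> (y - w) = - ((B'\<^sup>T *\<^sub>v a + c) \<bullet> (y - w))"
        unfolding g_def by (rule scalar_prod_uminus_left) (use carrier_vecD[OF c] carrier_vecD[OF w] in simp)
      also have "(B'\<^sup>T *\<^sub>v a + c) \<bullet> (y - w) = (B'\<^sup>T *\<^sub>v a) \<bullet> (y - w) + c \<bullet> (y - w)"
        by (rule add_scalar_prod_distrib[OF BT_a c yw])
      also have "c \<bullet> (y - w) = c \<bullet> y - c \<bullet> w" by (rule scalar_prod_minus_distrib[OF c y w])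
      also have "\<dots> = 0"
        using c_orth[OF yM] c_orth[OF w_M] comm_scalar_prod[OF c y] comm_scalar_prod[OF c w] by simp
      also have "(B'\<^sup>T *\<^sub>v a) \<bullet> (y - w) = a \<bullet> (B' *\<^sub>v (y - w))"
        by (rule transpose_vec_mult_scalar[OF B' yw a])
      also have "B' *\<^sub>v (y - w) = x - u"
        using mult_minus_distrib_mat_vec[OF B' y w] lift \<open>u = B' *\<^sub>v w\<close> by (simp add: y_def)
      finally show ?thesis by simp
    qed
    moreover have "\<psi> u + a \<bullet> (x - u) \<le> \<psi> x" using a_sub x by (auto simp: subdifferential_def)
    moreover have "?F w = (\<Sum>j<d. lam j * l1_norm (Bs j *\<^sub>v u))"
      using F_lift[OF u v] Bu \<open>w = z @\<^sub>v v\<close> by simp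
    moreover have "?F y = (\<Sum>j<d. lam j * l1_norm (Bs j *\<^sub>v x))"
      unfolding y_def by (rule F_lift[OF x v'])
    ultimately show ?thesis by linarith
  qed

  have z_entry: "z $ (offset m j + i) = (\<Sum>i'<l j. if i = k j i' then zs (offset m j + k j i') else 0)"
    if j: "j < d" and i: "i < m j" for j i
  proof -
    have "block m j z $ i = (\<Sum>i'\<in>{..<l j}. (zs (offset m j + k j i') \<cdot>\<^sub>v unit_vec (m j) (k j i')) $ i)"
      unfolding \<open>\<And>j. j < d \<Longrightarrow> block m j z = _ j\<close>[OF j] by (rule index_finsum_vec) (use i in auto)
    also have "\<dots> = (\<Sum>i'<l j. if i = k j i' then zs (offset m j + k j i') else 0)"
      using assms(21)[OF j] i by (intro sum.cong) auto
    finally show ?thesis using i by (simp add: block_def)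
  qed
  have z_support: "z $ (offset m j + k j i) = zs (offset m j + k j i)" if j: "j < d" and i: "i < l j" for j i
  proof -
    have "inj_on (k j) {..<l j}" using assms(20)[OF j] by (rule strict_mono_on_imp_inj_on)
    then have "(\<Sum>i'<l j. if k j i = k j i' then zs (offset m j + k j i') else 0)
        = (\<Sum>i'<l j. if i = i' then zs (offset m j + k j i) else 0)"
      using i by (intro sum.cong) (auto dest: inj_onD)
    then show ?thesis using z_entry[OF j, of "k j i"] assms(21)[OF j i] i by simp
  qed
  have z_off_support: "z $ (offset m j + i) = 0" if "j < d" "i < m j" "i \<notin> k j ` {..<l j}" for j i
    unfolding z_entry[OF that(1,2)] using that(3) by (intro sum.neutral) auto
  have c_b: "c $ (offset m j + i) = b $ (offset m j + i)" if "j < d" "i < m j" for j i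
    using block_pos[OF that] by (simp add: \<open>b = vec_first c p\<close> vec_first_def)

  show ?thesis
  proof (intro conjI allI impI ballI)
    show "is_arg_min (\<lambda>x. \<psi> x + (\<Sum>j<d. lam j * l1_norm (Bs j *\<^sub>v x))) (\<lambda>x. x \<in> carrier_vec n) u"
      unfolding is_arg_min_def using u optimal not_less by blast
    show "Bs j *\<^sub>v u \<in> sparse_vecs (m j) (l j)" if "j < d" for j
      unfolding Bs_block[OF that] Bu by (rule assms(23)[OF that])
    show "a \<in> subdifferential n (\<lambda>x. ereal (\<psi> x)) u" by (rule a_sub)
    show "b \<in> mat_kernel (B\<^sup>T)" by (rule b_ker)
    show "col B' i \<bullet> a = 0" if "i \<in> {..<N} - {..<p}" for i
    proof -
      have i: "p \<le> i" "i < N" using that by auto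
      then show ?thesis
        using l1_sub(1)[of i] c_tail[OF i] g_entry[of i] \<open>p = offset m d\<close> by simp
    qed
    show "lam j = - (col B' (offset m j + k j i) \<bullet> a + b $ (offset m j + k j i))
        * sgn (zs (offset m j + k j i))" if j: "j < d" and i: "i < l j" for j i
    proof -
      have ki: "k j i < m j" "zs (offset m j + k j i) \<noteq> 0" using assms(21)[OF j i] by auto
      have wz: "w $ (offset m j + k j i) = zs (offset m j + k j i)"
        using w_block[OF j ki(1)] z_support[OF j i] by simp
      have "offset m j + k j i < N" using block_pos[OF j ki(1)] N by simp
      then show ?thesis
        using l1_sub(2)[OF j ki(1)] wz ki(2) g_entry[of "offset m j + k j i"] c_b[OF j ki(1)] by simp
    qed
    show "\<bar>col B' (offset m j + i) \<bullet> a + b $ (offset m j + i)\<bar> \<le> lam j"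
      if j: "j < d" and i: "i \<in> {..<m j} - k j ` {..<l j}" for j i
    proof -
      have im: "i < m j" using i by simp
      have "w $ (offset m j + i) = 0" using w_block[OF j im] z_off_support[OF j im] i by simp
      moreover have "offset m j + i < N" using block_pos[OF j im] N by simp
      ultimately show ?thesis
        using l1_sub(3)[OF j im] g_entry[of "offset m j + i"] c_b[OF j im] by linarith
    qed
  qed
qed

end
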